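(* For each $j\in\{1,2,3\}$ and each $\varphi\in(\mathbb R/\pi\mathbb Z)^3$ one has a canonical $*$-isomorphism $$\rho_j:\ C_{\rm alg}(\mathbb R^4_{f_j(\varphi)})\to C_{\rm alg}(\mathbb R^4_\varphi)(\alpha_j)$$ which preserves the central element $\sum_\mu(x^\mu)^2$ (i.e. maps $\sum_\mu (x^\mu)^2$ formed with the generators of $C_{\rm alg}(\mathbb R^4_{f_j(\varphi)})$ to the element $\sum_\mu(x^\mu)^2$ formed in $C_{\rm alg}(\mathbb R^4_\varphi)$) and induces a corresponding isomorphism $S^3_{f_j(\varphi)}\simeq S^3_\varphi(\alpha_j)$.
   Context: $C_{\rm alg}(\mathbb R^4_\varphi)$ is the graded $*$-algebra generated by self-adjoint degree-one elements $x^0,\dots,x^3$ with relations, for $(k,\ell,m)$ cyclic permutations of $(1,2,3)$, $\sin(\varphi_k)(x^0x^k+x^kx^0)=i\cos(\varphi_\ell-\varphi_m)(x^\ell x^m-x^mx^\ell)$ and $\cos(\varphi_k)(x^0x^k-x^kx^0)=i\sin(\varphi_\ell-\varphi_m)(x^\ell x^m+x^mx^\ell)$. $C_{\rm alg}(S^3_\varphi)$ is its quotient by $\sum_\mu(x^\mu)^2=1$. The transformations $f_j$ are $f_1(\varphi)=(\pi-\varphi_1,\ \frac\pi2-\varphi_1+\varphi_2,\ \frac\pi2-\varphi_1+\varphi_3)$, $f_2(\varphi)=(\frac\pi2+\varphi_2-\varphi_3,\ \varphi_2,\ \frac\pi2-\varphi_1+\varphi_2)$, $f_3(\varphi)=(\frac\pi2-\varphi_2+\varphi_3,\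 \frac\pi2-\varphi_1+\varphi_3,\ \varphi_3)$. The automorphisms $\alpha_j$ of $C_{\rm alg}(\mathbb R^4_\varphi)$ act on $(x^0,x^1,x^2,x^3)$ by the diagonal signs $\alpha_1:(1,1,-1,-1)$, $\alpha_2:(1,-1,1,-1)$, $\alpha_3:(1,-1,-1,1)$. For a graded algebra $\mathcal A$ and a degree-$0$ automorphism $\alpha$, the semi-cross product $\mathcal A(\alpha)$ is the graded vector space $\mathcal A$ with product $a\cdot_\alpha b=a\,\alpha^n(b)$ for $a\in\mathcal A_n$, $b\in\mathcal A$; if $\mathcal A$ is a graded $*$-algebra, $\alpha$ commutes with $*$ and $\alpha^2=1$, then $\mathcal A(\alpha)$ is a graded $*$-algebra with involution $a^{*_\alpha}=\alpha^{-n}(a^* )$ for $a\in\mathcal A_n$. $S^3_\varphi(\alpha_j)$ denotes the noncommutative space whose algebra is the quotient of $C_{\rm alg}(\mathbb R^4_\varphi)(\alpha_j)$ by the two-sided ideal generated by $\sum_\mu(x^\mu)^2-1$ (the sum of squares being taken in $C_{\rm alg}(\mathbb R^4_\varphi)$). *)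

theory Defs
  imports
    "HOL-Analysis.Analysis"
    "HOL-Algebra.Module"
    "HOL-Algebra.QuotRing"
    "HOL-Library.Poly_Mapping"
begin

section \<open>Complex (graded) star-algebras\<close>

record 'a star_algebra = "(complex, 'a) module" +
  invol :: "'a \<Rightarrow> 'a"

text \<open>The grading is given by the family of homogeneous subspaces.\<close>

record 'a graded_star_algebra = "'a star_algebra" +
  homog :: "nat \<Rightarrow> 'a set"

definition star_iso ::
  "('a, 'm) star_algebra_scheme \<Rightarrow> ('b, 'n) star_algebra_scheme \<Rightarrow> ('a \<Rightarrow> 'b) set"
  where "star_iso A B =
    {h \<in> ring_iso A B.
       (\<forall>c. \<forall>a \<in> carrier A. h (c \<odot>\<^bsub>A\<^esub> a) = c \<odot>\<^bsub>B\<^esub> h a) \<and>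
       (\<forall>a \<in> carrier A. h (invol A a) = invol B (h a))}"

definition graded_star_iso ::
  "('a, 'm) graded_star_algebra_scheme \<Rightarrow> ('b, 'n) graded_star_algebra_scheme \<Rightarrow> ('a \<Rightarrow> 'b) set"
  where "graded_star_iso A B = {h \<in> star_iso A B. \<forall>n. h ` homog A n = homog B n}"

text \<open>
  The map induced by \<open>h\<close> on the cosets of \<open>I\<close>, in the style of \<^const>\<open>rcoset_mult\<close>: if
  \<open>h\<close> is additive and maps \<open>I\<close> into itself, then \<open>I +> a\<close> is sent to \<open>I +> h a\<close>.
\<close>

definition coset_map :: "('a, 'm) ring_scheme \<Rightarrow> 'a set \<Rightarrow> ('a \<Rightarrow> 'a) \<Rightarrow> 'a set \<Rightarrow> 'a set"
  where "coset_map R I h C = (\<Union>a\<in>C. I +>\<^bsub>R\<^esub> h a)"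

definition star_quot :: "('a, 'm) star_algebra_scheme \<Rightarrow> 'a set \<Rightarrow> 'a set star_algebra"
  where "star_quot A I =
    ring.extend (A Quot I)
      \<lparr>smult = (\<lambda>c. coset_map A I (\<lambda>a. c \<odot>\<^bsub>A\<^esub> a)),
       invol = coset_map A I (invol A)\<rparr>"

definition graded_star_quot ::
  "('a, 'm) graded_star_algebra_scheme \<Rightarrow> 'a set \<Rightarrow> 'a set graded_star_algebra"
  where "graded_star_quot A I =
    star_algebra.extend (star_quot A I)
      \<lparr>homog = (\<lambda>n. (\<lambda>a. I +>\<^bsub>A\<^esub> a) ` homog A n)\<rparr>"


section \<open>Semi-cross products\<close>

text \<open>The homogeneous components of an element.\<close>

definition hcomp :: "('a, 'm) graded_star_algebra_scheme \<Rightarrow> 'a \<Rightarrow> nat \<Rightarrow> 'a"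
  where "hcomp A a =
    (THE c. (\<forall>n. c n \<in> homog A n) \<and> finite {n. c n \<noteq> \<zero>\<^bsub>A\<^esub>} \<and>
            a = (\<Oplus>\<^bsub>A\<^esub>n\<in>{n. c n \<noteq> \<zero>\<^bsub>A\<^esub>}. c n))"

definition hdegs :: "('a, 'm) graded_star_algebra_scheme \<Rightarrow> 'a \<Rightarrow> nat set"
  where "hdegs A a = {n. hcomp A a n \<noteq> \<zero>\<^bsub>A\<^esub>}"

text \<open>
  For homogeneous \<open>a\<close> of degree \<open>n\<close> the product is \<open>a \<alpha>\<^sup>n(b)\<close> and the involution
  \<open>\<alpha>\<^sup>-\<^sup>n(a\<^sup>*)\<close>; both are extended additively in \<open>a\<close>.
\<close>

definition semicross ::
  "'a graded_star_algebra \<Rightarrow> ('a \<Rightarrow> 'a) \<Rightarrow> 'a graded_star_algebra"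
  where "semicross A \<alpha> =
    A\<lparr>mult := (\<lambda>a b. \<Oplus>\<^bsub>A\<^esub>n\<in>hdegs A a. hcomp A a n \<otimes>\<^bsub>A\<^esub> (\<alpha> ^^ n) b),
      invol := (\<lambda>a. \<Oplus>\<^bsub>A\<^esub>n\<in>hdegs A a.
                  (inv_into (carrier A) \<alpha> ^^ n) (invol A (hcomp A a n)))\<rparr>"


section \<open>The free star-algebra on four self-adjoint generators\<close>

text \<open>
  The generator \<open>x\<^sup>0\<close> has index \<^term>\<open>None\<close>, and \<open>x\<^sup>k\<close> has index \<^term>\<open>Some k\<close> for
  \<open>k\<close> in the three-element type \<^typ>\<open>3\<close>, whose elements are \<open>1, 2, 3\<close> and whose addition
  is modulo 3. Thus \<open>(k, k + 1, k + 2)\<close> runs through the cyclic permutations of \<open>(1, 2, 3)\<close>.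
\<close>

type_synonym ind = "3 option"

datatype word = Word (letters: "ind list")

instantiation word :: monoid_add
begin

definition "0 = Word []"
definition "u + v = Word (letters u @ letters v)"

instance
  by standard (simp_all add: zero_word_def plus_word_def)

end

type_synonym free = "word \<Rightarrow>\<^sub>0 complex"

definition scalar :: "complex \<Rightarrow> free"
  where "scalar c = Poly_Mapping.single 0 c"

definition gen :: "ind \<Rightarrow> free"
  where "gen \<mu> = Poly_Mapping.single (Word [\<mu>]) 1"

definition free_star :: "free \<Rightarrow> free"
  where "free_star p =
    (\<Sum>w\<in>Poly_Mapping.keys p.
       Poly_Mapping.single (Word (rev (letters w))) (cnj (Poly_Mapping.lookup p w)))"

definition free_algebra :: "free graded_star_algebra"
  where "free_algebra =
    \<lparr>carrier = UNIV, mult = (*), one = 1, zero = 0, add = (+),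
     smult = (\<lambda>c p. scalar c * p), invol = free_star,
     homog = (\<lambda>n. {p. \<forall>w\<in>Poly_Mapping.keys p. length (letters w) = n})\<rparr>"

text \<open>The substitution \<open>x\<^sup>\<mu> \<mapsto> \<epsilon>\<^sub>\<mu> x\<^sup>\<mu>\<close>.\<close>

definition free_diag :: "(ind \<Rightarrow> complex) \<Rightarrow> free \<Rightarrow> free"
  where "free_diag \<epsilon> p =
    (\<Sum>w\<in>Poly_Mapping.keys p.
       Poly_Mapping.single w (prod_list (map \<epsilon> (letters w)) * Poly_Mapping.lookup p w))"


section \<open>The noncommutative four-planes and three-spheres\<close>

text \<open>
  The defining relations depend on \<open>\<phi>\<close> itself, not only on its class modulo \<open>\<pi>\<close>: adding
  \<open>\<pi>\<close> to \<open>\<phi>\<^sub>k\<close> amounts to replacing \<open>x\<^sup>k\<close> by \<open>- x\<^sup>k\<close>. Points of \<open>(\<real>/\<pi>\<int>)\<^sup>3\<close> are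
  therefore given by representatives.
\<close>

definition relations :: "real^3 \<Rightarrow> free set"
  where "relations \<phi> =
    (\<Union>k::3. let l = k + 1; m = k + 2; x0 = gen None; x = (\<lambda>k. gen (Some k)) in
      {scalar (sin (\<phi>$k)) * (x0 * x k + x k * x0)
         - scalar (\<i> * cos (\<phi>$l - \<phi>$m)) * (x l * x m - x m * x l),
       scalar (cos (\<phi>$k)) * (x0 * x k - x k * x0)
         - scalar (\<i> * sin (\<phi>$l - \<phi>$m)) * (x l * x m + x m * x l)})"

definition R4_ideal :: "real^3 \<Rightarrow> free set"
  where "R4_ideal \<phi> = Idl\<^bsub>free_algebra\<^esub> (relations \<phi>)"

definition C_R4 :: "real^3 \<Rightarrow> free set graded_star_algebra"
  where "C_R4 \<phi> = graded_star_quot free_algebra (R4_ideal \<phi>)"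

definition xgen :: "real^3 \<Rightarrow> ind \<Rightarrow> free set"
  where "xgen \<phi> \<mu> = R4_ideal \<phi> +>\<^bsub>free_algebra\<^esub> gen \<mu>"

definition sum_sq :: "real^3 \<Rightarrow> free set"
  where "sum_sq \<phi> = (\<Oplus>\<^bsub>C_R4 \<phi>\<^esub>\<mu>\<in>UNIV. xgen \<phi> \<mu> \<otimes>\<^bsub>C_R4 \<phi>\<^esub> xgen \<phi> \<mu>)"

definition sphere_ideal :: "('a, 'm) star_algebra_scheme \<Rightarrow> 'a \<Rightarrow> 'a set"
  where "sphere_ideal A r = Idl\<^bsub>A\<^esub> {r \<ominus>\<^bsub>A\<^esub> \<one>\<^bsub>A\<^esub>}"

definition C_S3 :: "real^3 \<Rightarrow> free set set star_algebra"
  where "C_S3 \<phi> = star_quot (C_R4 \<phi>) (sphere_ideal (C_R4 \<phi>) (sum_sq \<phi>))"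

definition alpha_sign :: "3 \<Rightarrow> ind \<Rightarrow> complex"
  where "alpha_sign j \<mu> = (case \<mu> of None \<Rightarrow> 1 | Some k \<Rightarrow> if k = j then 1 else - 1)"

definition alpha :: "3 \<Rightarrow> real^3 \<Rightarrow> free set \<Rightarrow> free set"
  where "alpha j \<phi> = coset_map free_algebra (R4_ideal \<phi>) (free_diag (alpha_sign j))"

definition C_R4_semicross :: "3 \<Rightarrow> real^3 \<Rightarrow> free set graded_star_algebra"
  where "C_R4_semicross j \<phi> = semicross (C_R4 \<phi>) (alpha j \<phi>)"

text \<open>The sum of squares is the one formed in \<open>C_R4 \<phi>\<close>, not in the semi-cross product.\<close>

definition C_S3_semicross :: "3 \<Rightarrow> real^3 \<Rightarrow> free set set star_algebra"
  where "C_S3_semicross j \<phi> =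
    star_quot (C_R4_semicross j \<phi>) (sphere_ideal (C_R4_semicross j \<phi>) (sum_sq \<phi>))"

definition f_map :: "3 \<Rightarrow> real^3 \<Rightarrow> real^3"
  where "f_map j \<phi> =
    (if j = 1 then vector [pi - \<phi>$1, pi/2 - \<phi>$1 + \<phi>$2, pi/2 - \<phi>$1 + \<phi>$3]
     else if j = 2 then vector [pi/2 + \<phi>$2 - \<phi>$3, \<phi>$2, pi/2 - \<phi>$1 + \<phi>$2]
     else vector [pi/2 - \<phi>$2 + \<phi>$3, pi/2 - \<phi>$1 + \<phi>$3, \<phi>$3])"

text \<open>
  The effect on the generators of passing from the representative \<open>\<psi>\<close> to
  \<open>\<psi> + \<pi> n\<close>: the generator \<open>x\<^sup>k\<close> acquires the sign \<open>(-1)\<^sup>n\<^sup>k\<close>.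
\<close>

definition rep_sign :: "int^3 \<Rightarrow> ind \<Rightarrow> complex"
  where "rep_sign n \<mu> = (case \<mu> of None \<Rightarrow> 1 | Some k \<Rightarrow> (- 1) powi (n$k))"

end

theory Submission
  imports Defs
begin

text \<open>
  On generators \<open>\<rho>\<^sub>j\<close> exchanges \<open>x\<^sup>0\<close> and \<open>x\<^sup>j\<close>; for \<open>j = 1\<close> it keeps the
  two other generators in place and for \<open>j = 2, 3\<close> it exchanges them. Generators on which \<open>\<alpha>\<^sub>j\<close> is
  \<open>-1\<close> are multiplied by \<open>\<plusminus>\<i>\<close>: in the semi-cross product their involution and their square
  change sign, and the factor compensates both.

  This substitution is an isomorphism of the free algebra onto its own semi-cross product. Each
  defining relation at \<open>f\<^sub>j(\<phi>)\<close> goes to \<open>\<plusminus>\<close> a defining relation at \<open>\<phi>\<close>, all of them being reached. As the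
  ideal of relations is homogeneous and stable under \<open>*\<close> and \<open>\<alpha>\<^sub>j\<close>, everything descends to the quotients.
\<close>

section \<open>Additive maps on the free algebra\<close>

text \<open>The semi-cross product lives on the quotient and is built from homogeneous components
  given by a definite description, whereas computations with letters belong to the free algebra. Its
  product and involution are therefore rewritten on words, as \<open>twist_mult\<close> and
  \<open>twist_star\<close>; homogeneity of the ideal ensures that these represent the semi-cross
  operations on cosets.

  Moreover \<open>twist_subst\<close> is multiplicative only for the twisted product, so mapping
  relations to relations does not by itself map ideal to ideal. What helps is that a relation has
  even degree, so that twisted multiplication by it from the left is ordinary, and that it is an
  eigenvector of the automorphism: a translate u r v goes to a nonzero multiple of a translate.

  Angles are given up to multiples of pi. The resulting signs square to 1 and are absorbed in the
  coefficients \<open>c\<close>, which only have to be square roots of the signs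
  \<open>\<epsilon>\<close>. Associativity of the semi-cross product is not computed but transported
  along the isomorphism.\<close>

hide_const (open) Measure_Space.additive

abbreviation single :: "'w \<Rightarrow> 'c::zero \<Rightarrow> 'w \<Rightarrow>\<^sub>0 'c"
  where "single \<equiv> Poly_Mapping.single"

abbreviation len :: "word \<Rightarrow> nat"
  where "len w \<equiv> length (letters w)"

text \<open>The coefficient is an argument of \<open>f\<close> rather than a factor, so that
  conjugate-linear maps such as the involution are covered as well.\<close>

definition lin_ext :: "('w \<Rightarrow> 'c::ab_group_add \<Rightarrow> 'b::ab_group_add) \<Rightarrow> ('w \<Rightarrow>\<^sub>0 'c) \<Rightarrow> 'b"
  where "lin_ext f p = (\<Sum>w\<in>Poly_Mapping.keys p. f w (Poly_Mapping.lookup p w))"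

lemma additive_lin_ext:
  fixes f :: "'w \<Rightarrow> 'c::ab_group_add \<Rightarrow> 'b::ab_group_add"
  assumes "\<And>w. additive (f w)"
  shows "additive (lin_ext f)"
proof
  fix p q :: "'w \<Rightarrow>\<^sub>0 'c"
  \<comment> \<open>The three sums run over different supports; padding with zero terms puts them
    over a common one.\<close>
  have sup: "lin_ext f r = (\<Sum>w\<in>Poly_Mapping.keys p \<union> Poly_Mapping.keys q. f w (Poly_Mapping.lookup r w))"
    if "Poly_Mapping.keys r \<subseteq> Poly_Mapping.keys p \<union> Poly_Mapping.keys q" for r :: "'w \<Rightarrow>\<^sub>0 'c"
    unfolding lin_ext_def using that
    by (intro sum.mono_neutral_left) (auto simp: in_keys_iff additive.zero[OF assms])
  have "Poly_Mapping.keys (p + q) \<subseteq> Poly_Mapping.keys p \<union> Poly_Mapping.keys q"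
    by (rule Poly_Mapping.keys_add)
  then show "lin_ext f (p + q) = lin_ext f p + lin_ext f q"
    by (simp add: sup lookup_add additive.add[OF assms] sum.distrib)
qed

lemma lin_ext_single:
  assumes "additive (f w)"
  shows "lin_ext f (single w a) = f w a"
  by (simp add: lin_ext_def additive.zero[OF assms])

lemma sum_single: "(\<Sum>w\<in>Poly_Mapping.keys p. single w (Poly_Mapping.lookup p w)) = p"
  by (rule poly_mapping_eqI) (auto simp: lookup_sum lookup_single when_def in_keys_iff)

lemma additive_eqI:
  assumes "additive f" "additive g" "\<And>w a. f (single w a) = g (single w a)"
  shows "f p = g p"
proof -
  have "f (\<Sum>w\<in>Poly_Mapping.keys p. single w (Poly_Mapping.lookup p w)) =
        g (\<Sum>w\<in>Poly_Mapping.keys p. single w (Poly_Mapping.lookup p w))"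
    by (simp add: additive.sum[OF assms(1)] additive.sum[OF assms(2)] assms(3))
  then show ?thesis by (simp add: sum_single)
qed

named_theorems additive_intros

text \<open>Stated for composites with an inner \<open>g\<close>, like most rules of this
  collection, so that additivity of a nested expression is found by peeling off one map at a
  time.\<close>

lemma additive_lin_ext_comp [additive_intros]:
  assumes "\<And>w. additive (f w)" "additive g"
  shows "additive (\<lambda>x. lin_ext f (g x))"
  using additive_lin_ext[of f, OF assms(1)] assms(2) by (simp add: Modules.additive_def)

lemma additive_funpow:
  fixes f :: "'b::ab_group_add \<Rightarrow> 'b"
  shows "additive f \<Longrightarrow> additive (f ^^ n)"
  by (induction n) (simp_all add: Modules.additive_def)

lemma additive_if [additive_intros]:
  "additive f \<Longrightarrow> additive g \<Longrightarrow> additive (\<lambda>p. if b then f p else g p)"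
  by (cases b) auto

lemma additive_single [additive_intros]: "additive g \<Longrightarrow> additive (\<lambda>x. single w (g x))"
  by (simp add: Modules.additive_def single_add)

lemma additive_zero [additive_intros]: "additive (\<lambda>_. 0)"
  by standard simp

lemma additive_id [additive_intros]: "additive (\<lambda>a. a)"
  by standard simp

lemma additive_mult_left [additive_intros]: "additive g \<Longrightarrow> additive (\<lambda>x. a * g x :: 'b::ring)"
  by (simp add: Modules.additive_def distrib_left)

lemma additive_mult_right [additive_intros]: "additive g \<Longrightarrow> additive (\<lambda>x. g x * a :: 'b::ring)"
  by (simp add: Modules.additive_def distrib_right)

lemma additive_cnj [additive_intros]: "additive g \<Longrightarrow> additive (\<lambda>x. cnj (g x))"
  by (simp add: Modules.additive_def)

lemma plus_Word [simp]: "Word u + Word v = Word (u @ v)"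
  by (simp add: plus_word_def)

lemma letters_plus [simp]: "letters (u + v) = letters u @ letters v"
  by (simp add: plus_word_def)

lemma letters_zero [simp]: "letters 0 = []"
  by (simp add: zero_word_def)


section \<open>Diagonal sign changes and the involution on monomials\<close>

definition diag_coeff :: "(ind \<Rightarrow> complex) \<Rightarrow> word \<Rightarrow> complex"
  where "diag_coeff \<epsilon> w = prod_list (map \<epsilon> (letters w))"

lemma free_diag_lin_ext: "free_diag \<epsilon> = lin_ext (\<lambda>w a. single w (diag_coeff \<epsilon> w * a))"
  by (simp add: fun_eq_iff free_diag_def lin_ext_def diag_coeff_def)

lemma additive_free_diag [additive_intros]: "additive g \<Longrightarrow> additive (\<lambda>x. free_diag \<epsilon> (g x))"
  unfolding free_diag_lin_ext by (intro additive_intros)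

lemma free_diag_single [simp]: "free_diag \<epsilon> (single w a) = single w (diag_coeff \<epsilon> w * a)"
  unfolding free_diag_lin_ext by (intro lin_ext_single additive_intros)

lemma free_diag_funpow_single [simp]:
  "(free_diag \<epsilon> ^^ n) (single w a) = single w (diag_coeff \<epsilon> w ^ n * a)"
  by (induction n) (simp_all add: mult.assoc)

lemma diag_coeff_plus [simp]: "diag_coeff \<epsilon> (u + v) = diag_coeff \<epsilon> u * diag_coeff \<epsilon> v"
  by (simp add: diag_coeff_def)

lemma additive_free_diag_funpow [additive_intros]:
  "additive g \<Longrightarrow> additive (\<lambda>x. (free_diag \<epsilon> ^^ n) (g x))"
  using additive_funpow[OF additive_free_diag[OF additive_id]] by (simp add: Modules.additive_def)

lemma diag_coeff_square:
  assumes "\<And>\<mu>. \<epsilon> \<mu> * \<epsilon> \<mu> = 1"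
  shows "diag_coeff \<epsilon> w * diag_coeff \<epsilon> w = 1"
proof -
  have "prod_list (map \<epsilon> u) * prod_list (map \<epsilon> u) = 1" for u
  proof (induction u)
    case (Cons \<mu> u)
    have "prod_list (map \<epsilon> (\<mu> # u)) * prod_list (map \<epsilon> (\<mu> # u)) =
        (\<epsilon> \<mu> * \<epsilon> \<mu>) * (prod_list (map \<epsilon> u) * prod_list (map \<epsilon> u))"
      by (simp add: mult_ac)
    then show ?case by (simp add: Cons.IH assms)
  qed simp
  then show ?thesis by (simp add: diag_coeff_def)
qed

lemma free_star_lin_ext: "free_star = lin_ext (\<lambda>w a. single (Word (rev (letters w))) (cnj a))"
  by (simp add: fun_eq_iff free_star_def lin_ext_def)

lemma additive_free_star [additive_intros]: "additive g \<Longrightarrow> additive (\<lambda>x. free_star (g x))"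
  unfolding free_star_lin_ext by (intro additive_intros)

lemma free_star_single [simp]: "free_star (single w a) = single (Word (rev (letters w))) (cnj a)"
  unfolding free_star_lin_ext by (rule lin_ext_single) (intro additive_intros)

lemma additive2_eqI:
  assumes "\<And>q. additive (\<lambda>p. f p q)" "\<And>q. additive (\<lambda>p. g p q)"
    and "\<And>p. additive (f p)" "\<And>p. additive (g p)"
    and "\<And>u a v b. f (single u a) (single v b) = g (single u a) (single v b)"
  shows "f p q = g p q"
  by (rule additive_eqI[of "\<lambda>p. f p q" "\<lambda>p. g p q"], fact, fact, rule additive_eqI, fact, fact, fact)

lemma free_diag_mult: "free_diag \<epsilon> (p * q) = free_diag \<epsilon> p * free_diag \<epsilon> q"
  by (rule additive2_eqI[of "\<lambda>p q. free_diag \<epsilon> (p * q)" "\<lambda>p q. free_diag \<epsilon> p * free_diag \<epsilon> q"])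
    (intro additive_intros | simp add: mult_single ac_simps)+

lemma free_star_mult: "free_star (p * q) = free_star q * free_star p"
  by (rule additive2_eqI[of "\<lambda>p q. free_star (p * q)" "\<lambda>p q. free_star q * free_star p"])
    (intro additive_intros | simp add: mult_single ac_simps)+

lemma single_zero_central: "p * single (0::word) a = single 0 (a::complex) * p"
  by (rule additive_eqI[of "\<lambda>p. p * single 0 a"])
    (intro additive_intros | simp add: mult_single ac_simps)+

section \<open>Homogeneous components and the semi-cross operations on the free algebra\<close>

definition free_comp :: "nat \<Rightarrow> free \<Rightarrow> free"
  where "free_comp n = lin_ext (\<lambda>w a. if len w = n then single w a else 0)"

lemma additive_free_comp [additive_intros]: "additive g \<Longrightarrow> additive (\<lambda>x. free_comp n (g x))"
  unfolding free_comp_def by (intro additive_intros)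

lemma free_comp_single [simp]: "free_comp n (single w a) = (if len w = n then single w a else 0)"
  unfolding free_comp_def by (rule lin_ext_single) (intro additive_intros)

text \<open>The semi-cross product of the free algebra by \<open>free_diag \<epsilon>\<close>, each
  word of the left factor acting according to its length. The word-by-word form makes it biadditive,
  hence testable on monomials.\<close>

definition twist_mult :: "(ind \<Rightarrow> complex) \<Rightarrow> free \<Rightarrow> free \<Rightarrow> free"
  where "twist_mult \<epsilon> p q = lin_ext (\<lambda>w a. single w a * (free_diag \<epsilon> ^^ len w) q) p"

lemma additive_twist_mult1 [additive_intros]:
  "additive g \<Longrightarrow> additive (\<lambda>x. twist_mult \<epsilon> (g x) q)"
  unfolding twist_mult_def by (intro additive_intros)

lemma additive_twist_mult2 [additive_intros]:
  "additive g \<Longrightarrow> additive (\<lambda>x. twist_mult \<epsilon> p (g x))"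
  by (simp add: Modules.additive_def twist_mult_def lin_ext_def distrib_left sum.distrib
    additive.add[OF additive_free_diag_funpow[OF additive_id]])

lemma twist_mult_single [simp]:
  "twist_mult \<epsilon> (single w a) q = single w a * (free_diag \<epsilon> ^^ len w) q"
  unfolding twist_mult_def by (rule lin_ext_single) (intro additive_intros)

text \<open>Powers of the map itself stand where the semi-cross involution has powers of its
  inverse: for signs \<open>\<epsilon>\<close> the diagonal map is its own inverse.\<close>

definition twist_star :: "(ind \<Rightarrow> complex) \<Rightarrow> free \<Rightarrow> free"
  where "twist_star \<epsilon> = lin_ext (\<lambda>w a. (free_diag \<epsilon> ^^ len w) (free_star (single w a)))"

lemma additive_twist_star [additive_intros]: "additive g \<Longrightarrow> additive (\<lambda>x. twist_star \<epsilon> (g x))"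
  unfolding twist_star_def by (intro additive_intros)

lemma twist_star_single [simp]:
  "twist_star \<epsilon> (single w a) = (free_diag \<epsilon> ^^ len w) (free_star (single w a))"
  unfolding twist_star_def by (rule lin_ext_single) (intro additive_intros)

text \<open>These are the degrees of a representative; its class may have fewer, since a component
  can lie in the ideal of relations.\<close>

definition degs :: "free \<Rightarrow> nat set"
  where "degs p = (\<lambda>w. len w) ` Poly_Mapping.keys p"

lemma finite_degs [simp]: "finite (degs p)"
  by (simp add: degs_def)

lemma free_comp_eq_sum:
  "free_comp n p = (\<Sum>w\<in>{w \<in> Poly_Mapping.keys p. len w = n}. single w (Poly_Mapping.lookup p w))"
  by (simp add: free_comp_def lin_ext_def sum.inter_filter)

lemma free_comp_eq_0: "n \<notin> degs p \<Longrightarrow> free_comp n p = 0"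
  by (auto simp: free_comp_eq_sum degs_def intro: sum.neutral)

lemma twist_mult_eq_sum:
  "twist_mult \<epsilon> p q = (\<Sum>n\<in>degs p. free_comp n p * (free_diag \<epsilon> ^^ n) q)"
proof -
  have "(\<Sum>n\<in>degs p. free_comp n p * (free_diag \<epsilon> ^^ n) q) =
    (\<Sum>n\<in>degs p. \<Sum>w\<in>{w \<in> Poly_Mapping.keys p. len w = n}.
        single w (Poly_Mapping.lookup p w) * (free_diag \<epsilon> ^^ len w) q)"
    by (auto simp: free_comp_eq_sum sum_distrib_right intro!: sum.cong)
  also have "\<dots> = twist_mult \<epsilon> p q"
    unfolding twist_mult_def lin_ext_def degs_def by (rule sum.image_gen[symmetric]) simp
  finally show ?thesis ..
qed

lemma twist_star_eq_sum:
  "twist_star \<epsilon> p = (\<Sum>n\<in>degs p. (free_diag \<epsilon> ^^ n) (free_star (free_comp n p)))"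
proof -
  have "(\<Sum>n\<in>degs p. (free_diag \<epsilon> ^^ n) (free_star (free_comp n p))) =
    (\<Sum>n\<in>degs p. \<Sum>w\<in>{w \<in> Poly_Mapping.keys p. len w = n}.
        (free_diag \<epsilon> ^^ len w) (free_star (single w (Poly_Mapping.lookup p w))))"
    by (auto simp: free_comp_eq_sum additive.sum[OF additive_free_star[OF additive_id]]
        additive.sum[OF additive_free_diag_funpow[OF additive_id]] intro!: sum.cong)
  also have "\<dots> = twist_star \<epsilon> p"
    unfolding twist_star_def lin_ext_def degs_def by (rule sum.image_gen[symmetric]) simp
  finally show ?thesis ..
qed

lemma sum_free_comp: "(\<Sum>n\<in>degs p. free_comp n p) = p"
proof -
  have "(\<Sum>n\<in>degs p. free_comp n p) = (\<Sum>w\<in>Poly_Mapping.keys p. single w (Poly_Mapping.lookup p w))"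
    unfolding free_comp_eq_sum degs_def by (rule sum.image_gen[symmetric]) simp
  then show ?thesis by (simp add: sum_single)
qed

text \<open>Homogeneity becomes a fixed-point equation of an additive projection, which passes
  through every map commuting with it.\<close>

lemma homog_free: "homog free_algebra n = {p. free_comp n p = p}"
proof (intro equalityI subsetI)
  fix p assume "p \<in> homog free_algebra n"
  then have "{w \<in> Poly_Mapping.keys p. len w = n} = Poly_Mapping.keys p"
    by (auto simp: free_algebra_def)
  then show "p \<in> {p. free_comp n p = p}"
    by (simp add: free_comp_eq_sum sum_single)
next
  fix p assume "p \<in> {p. free_comp n p = p}"
  then have p: "p = (\<Sum>w\<in>{w \<in> Poly_Mapping.keys p. len w = n}. single w (Poly_Mapping.lookup p w))"
    by (simp add: free_comp_eq_sum)
  have "len w = n" if "w \<in> Poly_Mapping.keys p" for w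
  proof (rule ccontr)
    assume "len w \<noteq> n"
    then have "Poly_Mapping.lookup p w = 0"
      by (subst p) (auto simp: lookup_sum lookup_single when_def intro!: sum.neutral)
    with that show False by (simp add: in_keys_iff)
  qed
  then show "p \<in> homog free_algebra n"
    by (auto simp: free_algebra_def)
qed

lemma free_comp_free_comp [simp]: "free_comp m (free_comp n p) = (if m = n then free_comp n p else 0)"
  by (rule additive_eqI[of "\<lambda>p. free_comp m (free_comp n p)"])
    (intro additive_intros | simp add: additive.zero[OF additive_free_comp[OF additive_id]])+

section \<open>Twisted substitutions\<close>

text \<open>The conditions on a substitution sending each generator to \<open>c\<close> times a
  permuted generator; \<open>\<pi>\<close> is a map of indices here, not the number. Leaving
  \<open>c\<close> arbitrary covers all representatives of the angles at once.\<close>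

locale twist =
  fixes \<epsilon> c :: "ind \<Rightarrow> complex" and \<pi> :: "ind \<Rightarrow> ind"
  assumes sign: "\<epsilon> \<mu> = 1 \<or> \<epsilon> \<mu> = -1"
    and perm [simp]: "\<pi> (\<pi> \<mu>) = \<mu>" "\<epsilon> (\<pi> \<mu>) = \<epsilon> \<mu>"
    and coeff_sq: "c \<mu> * c \<mu> = \<epsilon> \<mu>"
begin

definition perm_word :: "word \<Rightarrow> word"
  where "perm_word w = Word (map \<pi> (letters w))"

text \<open>
  In the semi-cross product a letter, being of degree one, applies the automorphism once to everything to its
  right; this is the source of the product of the signs of the later letters.
\<close>

primrec twist_coeff :: "ind list \<Rightarrow> complex"
  where "twist_coeff [] = 1"
  | "twist_coeff (\<mu> # w) = c \<mu> * prod_list (map \<epsilon> w) * twist_coeff w"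

definition twist_subst :: "free \<Rightarrow> free"
  where "twist_subst = lin_ext (\<lambda>w a. single (perm_word w) (twist_coeff (letters w) * a))"

lemma eps_sq [simp]: "\<epsilon> \<mu> * \<epsilon> \<mu> = 1"
  using sign[of \<mu>] by auto

lemma cnj_eps [simp]: "cnj (\<epsilon> \<mu>) = \<epsilon> \<mu>"
  using sign[of \<mu>] by auto

lemma eps_nonzero [simp]: "\<epsilon> \<mu> \<noteq> 0"
  using sign[of \<mu>] by auto

lemma coeff_nonzero [simp]: "c \<mu> \<noteq> 0"
  using coeff_sq[of \<mu>] by auto

text \<open>The square roots of 1 are real, those of -1 imaginary. The identity says that
  \<open>c\<close> times a generator is self-adjoint for the twisted involution.\<close>

lemma cnj_coeff: "cnj (c \<mu>) = \<epsilon> \<mu> * c \<mu>"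
proof (cases "\<epsilon> \<mu> = 1")
  case True
  then have "c \<mu> = 1 \<or> c \<mu> = -1"
    using coeff_sq[of \<mu>] by (simp add: square_eq_1_iff)
  with True show ?thesis by auto
next
  case False
  then have eps: "\<epsilon> \<mu> = -1" using sign by blast
  then have "(c \<mu> - \<i>) * (c \<mu> + \<i>) = 0"
    using coeff_sq[of \<mu>] by (simp add: algebra_simps)
  then have "c \<mu> = \<i> \<or> c \<mu> = - \<i>"
    by (auto simp: eq_neg_iff_add_eq_0)
  with eps show ?thesis by auto
qed

lemma diag_coeff_sq [simp]: "diag_coeff \<epsilon> w * diag_coeff \<epsilon> w = 1"
  by (rule diag_coeff_square) simp

lemma perm_word_perm_word [simp]: "perm_word (perm_word w) = w"
  by (cases w) (simp add: perm_word_def o_def)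

lemma perm_word_plus [simp]: "perm_word (u + v) = perm_word u + perm_word v"
  by (simp add: perm_word_def)

lemma len_perm_word [simp]: "len (perm_word w) = len w"
  by (simp add: perm_word_def)

lemma diag_coeff_perm_word [simp]: "diag_coeff \<epsilon> (perm_word w) = diag_coeff \<epsilon> w"
  by (simp add: diag_coeff_def perm_word_def o_def)

lemma twist_coeff_nonzero [simp]: "twist_coeff u \<noteq> 0"
  by (induction u) (auto simp: prod_list_zero_iff)

text \<open>Each letter of \<open>u\<close> has all of \<open>v\<close> to its right, so the sign of
  \<open>v\<close> enters once per letter of \<open>u\<close>.\<close>

lemma twist_coeff_append:
  "twist_coeff (u @ v) = twist_coeff u * twist_coeff v * prod_list (map \<epsilon> v) ^ length u"
  by (induction u) simp_all

lemma twist_coeff_rev: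
  "twist_coeff (rev u) = cnj (twist_coeff u) * prod_list (map \<epsilon> u) ^ length u"
proof (induction u)
  case (Cons \<mu> u)
  let ?e = "prod_list (map \<epsilon> u)"
  have sq: "?e * ?e = 1"
    using diag_coeff_sq[of "Word u"] by (simp add: diag_coeff_def)
  have cnj: "cnj ?e = ?e"
    by (induction u) simp_all
  have "twist_coeff (rev (\<mu> # u)) = twist_coeff (rev u) * c \<mu> * \<epsilon> \<mu> ^ length u"
    by (simp add: twist_coeff_append)
  \<comment> \<open>The inserted squares equal 1. They supply one sign of \<open>\<mu>\<close> for
    conjugating \<open>c \<mu>\<close>, one \<open>?e\<close> for the definition of
    \<open>twist_coeff\<close>, and one of each for the exponent growing by one.\<close>
  also have "\<dots> = cnj (twist_coeff u) * ?e ^ length u * c \<mu> * \<epsilon> \<mu> ^ length u * ((\<epsilon> \<mu> * \<epsilon> \<mu>) * (?e * ?e))"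
    by (simp add: Cons.IH sq)
  also have "\<dots> = cnj (twist_coeff (\<mu> # u)) * prod_list (map \<epsilon> (\<mu> # u)) ^ length (\<mu> # u)"
    by (simp add: cnj cnj_coeff power_mult_distrib mult_ac)
  finally show ?case .
qed simp

lemma additive_twist_subst [additive_intros]: "additive g \<Longrightarrow> additive (\<lambda>x. twist_subst (g x))"
  unfolding twist_subst_def by (intro additive_intros)

lemma twist_subst_single [simp]:
  "twist_subst (single w a) = single (perm_word w) (twist_coeff (letters w) * a)"
  unfolding twist_subst_def by (rule lin_ext_single) (intro additive_intros)

text \<open>On monomials the power in \<open>twist_coeff_append\<close> is exactly the action of the
  automorphism on the right factor; \<open>perm_word\<close> changes neither lengths nor
  signs.\<close>

lemma twist_subst_mult: "twist_subst (p * q) = twist_mult \<epsilon> (twist_subst p) (twist_subst q)"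
  by (rule additive2_eqI[of "\<lambda>p q. twist_subst (p * q)"
        "\<lambda>p q. twist_mult \<epsilon> (twist_subst p) (twist_subst q)"])
    (intro additive_intros |
      simp add: mult_single twist_coeff_append diag_coeff_def[symmetric] mult_ac)+

lemma twist_subst_star: "twist_subst (free_star p) = twist_star \<epsilon> (twist_subst p)"
proof -
  have prod_rev: "prod_list (map \<epsilon> (rev u)) = prod_list (map \<epsilon> u)" for u
    by (metis prod_list.rev rev_map)
  show ?thesis
    by (rule additive_eqI[of "\<lambda>p. twist_subst (free_star p)"])
      (intro additive_intros |
        simp add: twist_coeff_rev perm_word_def diag_coeff_def o_def rev_map prod_rev mult_ac)+
qed

lemma free_comp_twist_subst: "free_comp n (twist_subst p) = twist_subst (free_comp n p)"
  by (rule additive_eqI[of "\<lambda>p. free_comp n (twist_subst p)"])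
    (intro additive_intros | simp add: additive.zero[OF additive_twist_subst[OF additive_id]])+

lemma bij_twist_subst: "bij twist_subst"
proof (rule bijI')
  \<comment> \<open>The word \<open>w\<close> is reached from \<open>perm_word w\<close>, so it is
    the coefficient of the latter that is divided out.\<close>
  define inv_subst :: "free \<Rightarrow> free"
    where "inv_subst = lin_ext (\<lambda>w a. single (perm_word w) (a / twist_coeff (letters (perm_word w))))"
  have add: "additive (\<lambda>a. single (perm_word w) (a / twist_coeff (letters (perm_word w))))" for w
    by (simp add: Modules.additive_def add_divide_distrib single_add)
  have inv_add: "additive g \<Longrightarrow> additive (\<lambda>x. inv_subst (g x))" for g :: "free \<Rightarrow> free"
    unfolding inv_subst_def by (intro additive_intros add)
  have inv_single: "inv_subst (single w a) = single (perm_word w) (a / twist_coeff (letters (perm_word w)))" for w a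
    unfolding inv_subst_def by (rule lin_ext_single) (rule add)
  have left: "inv_subst (twist_subst p) = p" for p
    by (rule additive_eqI[of "\<lambda>p. inv_subst (twist_subst p)"])
      (intro additive_intros inv_add | simp add: inv_single)+
  have right: "twist_subst (inv_subst p) = p" for p
    by (rule additive_eqI[of "\<lambda>p. twist_subst (inv_subst p)"])
      (intro additive_intros inv_add | simp add: inv_single)+
  show "twist_subst p = twist_subst q \<longleftrightarrow> p = q" for p q
    using left by metis
  show "\<exists>p. q = twist_subst p" for q
    using right by metis
qed

end


section \<open>The ideal of relations\<close>

lemma free_algebra_simps [simp]:
  "carrier free_algebra = UNIV" "p \<otimes>\<^bsub>free_algebra\<^esub> q = p * q" "\<one>\<^bsub>free_algebra\<^esub> = 1"
  "\<zero>\<^bsub>free_algebra\<^esub> = 0" "p \<oplus>\<^bsub>free_algebra\<^esub> q = p + q"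
  "a \<odot>\<^bsub>free_algebra\<^esub> p = scalar a * p" "invol free_algebra = free_star"
  by (simp_all add: free_algebra_def)

lemma ring_free_algebra: "ring free_algebra"
proof (intro ringI abelian_groupI monoidI)
  show "\<exists>q\<in>carrier free_algebra. q \<oplus>\<^bsub>free_algebra\<^esub> p = \<zero>\<^bsub>free_algebra\<^esub>" for p
    by (rule bexI[of _ "- p"]) simp_all
qed (simp_all add: algebra_simps)

interpretation free: ring free_algebra
  by (rule ring_free_algebra)

lemma a_inv_free [simp]: "\<ominus>\<^bsub>free_algebra\<^esub> p = - p"
  by (rule free.minus_equality) simp_all

text \<open>The two-sided ideal generated by \<open>S\<close>, presented by translates with words
  because \<open>twist_subst\<close> is explicit on words. Scalars are central, so one coefficient,
  on the left, is enough.\<close>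

inductive_set span2 :: "free set \<Rightarrow> free set" for S :: "free set"
  where
    zero: "0 \<in> span2 S"
  | add: "p \<in> span2 S \<Longrightarrow> q \<in> span2 S \<Longrightarrow> p + q \<in> span2 S"
  | gen: "r \<in> S \<Longrightarrow> single u a * r * single v 1 \<in> span2 S"

lemma span2_mult_left: "q \<in> span2 S \<Longrightarrow> p * q \<in> span2 S"
proof (induction rule: span2.induct)
  case (gen r u a v)
  have "(\<Sum>w\<in>K. single w (f w)) * (single u a * r * single v 1) \<in> span2 S" if "finite K" for K f
    using that
    by (induction K rule: finite_induct)
      (auto simp: distrib_right mult.assoc[symmetric] mult_single intro!: span2.intros gen)
  from this[of "Poly_Mapping.keys p" "Poly_Mapping.lookup p"] show ?case
    by (simp add: sum_single)
qed (auto simp: distrib_left intro: span2.intros)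

lemma span2_mult_right: "q \<in> span2 S \<Longrightarrow> q * p \<in> span2 S"
proof (induction rule: span2.induct)
  case (gen r u a v)
  \<comment> \<open>The scalar \<open>b\<close> is moved through \<open>r\<close> to the left word,
    since the right word in \<open>span2\<close> carries coefficient 1.\<close>
  have one: "(single u a * r * single v 1) * single w b = single u (a * b) * r * single (v + w) 1" for w b
  proof -
    have "(single u a * r * single v 1) * single w b = single u a * ((r * single (v + w) 1) * single 0 b)"
      by (simp add: mult.assoc mult_single)
    also have "\<dots> = single u (a * b) * r * single (v + w) 1"
      unfolding single_zero_central by (simp add: mult_single flip: mult.assoc)
    finally show ?thesis .
  qed
  have "(single u a * r * single v 1) * (\<Sum>w\<in>K. single w (f w)) \<in> span2 S" if "finite K" for K f
    using that
    by (induction K rule: finite_induct) (auto simp: distrib_left one intro!: span2.intros gen)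
  from this[of "Poly_Mapping.keys p" "Poly_Mapping.lookup p"] show ?case
    by (simp add: sum_single)
qed (auto simp: distrib_right intro: span2.intros)

lemma ideal_span2: "ideal (span2 S) free_algebra"
proof (rule idealI[OF ring_free_algebra])
  have "- p \<in> span2 S" if "p \<in> span2 S" for p
    using span2_mult_left[OF that, of "-1"] by simp
  then show "subgroup (span2 S) (add_monoid free_algebra)"
    by (intro free.add.subgroupI) (auto intro: span2.intros simp: a_inv_def[symmetric])
qed (auto intro: span2_mult_left span2_mult_right)

lemma genideal_free: "Idl\<^bsub>free_algebra\<^esub> S = span2 S"
proof (rule equalityI)
  have "r \<in> span2 S" if "r \<in> S" for r
    using span2.gen[OF that, of 0 1 0] by simp
  then show "Idl\<^bsub>free_algebra\<^esub> S \<subseteq> span2 S"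
    by (intro free.genideal_minimal ideal_span2) blast
  interpret I: ideal "Idl\<^bsub>free_algebra\<^esub> S" free_algebra
    by (rule free.genideal_ideal) simp
  show "span2 S \<subseteq> Idl\<^bsub>free_algebra\<^esub> S"
  proof
    fix p assume "p \<in> span2 S"
    then show "p \<in> Idl\<^bsub>free_algebra\<^esub> S"
    proof (induction rule: span2.induct)
      case (gen r u a v)
      then have "r \<in> Idl\<^bsub>free_algebra\<^esub> S"
        using free.genideal_self[of S] by auto
      then show ?case
        using I.I_l_closed I.I_r_closed by simp
    qed (use I.zero_closed I.a_closed in auto)
  qed
qed

text \<open>
  \<open>quad a b s k\<close> stands for \<open>a (x\<^sup>0 x\<^sup>k + s x\<^sup>k x\<^sup>0) - b (x\<^sup>l x\<^sup>m - s x\<^sup>m x\<^sup>l)\<close> with \<open>s = \<plusminus>1\<close>; the left and right sides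
  of both families of relations have this form.
\<close>

definition quad :: "complex \<Rightarrow> complex \<Rightarrow> complex \<Rightarrow> 3 \<Rightarrow> free"
  where "quad a b s k =
    single (Word [None, Some k]) a + single (Word [Some k, None]) (s * a)
    - single (Word [Some (k + 1), Some (k + 2)]) b + single (Word [Some (k + 2), Some (k + 1)]) (s * b)"

definition relator :: "real^3 \<Rightarrow> bool \<Rightarrow> 3 \<Rightarrow> free"
  where "relator \<phi> t k =
    (if t then quad (sin (\<phi>$k)) (\<i> * cos (\<phi>$(k + 1) - \<phi>$(k + 2))) 1 k
     else quad (cos (\<phi>$k)) (\<i> * sin (\<phi>$(k + 1) - \<phi>$(k + 2))) (-1) k)"

lemma relations_eq: "relations \<phi> = {relator \<phi> t k | t k. True}"
proof -
  have [simp]: "single w (- a) = - single w (a::complex)" for w :: word and a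
    by (simp add: single_uminus)
  have "scalar (sin (\<phi>$k)) * (gen None * gen (Some k) + gen (Some k) * gen None)
      - scalar (\<i> * cos (\<phi>$(k + 1) - \<phi>$(k + 2)))
        * (gen (Some (k + 1)) * gen (Some (k + 2)) - gen (Some (k + 2)) * gen (Some (k + 1)))
      = relator \<phi> True k"
    "scalar (cos (\<phi>$k)) * (gen None * gen (Some k) - gen (Some k) * gen None)
      - scalar (\<i> * sin (\<phi>$(k + 1) - \<phi>$(k + 2)))
        * (gen (Some (k + 1)) * gen (Some (k + 2)) + gen (Some (k + 2)) * gen (Some (k + 1)))
      = relator \<phi> False k" for k
    by (simp_all add: relator_def quad_def scalar_def gen_def mult_single algebra_simps)
  then have "relations \<phi> = (\<Union>k. {relator \<phi> True k, relator \<phi> False k})"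
    by (simp add: relations_def Let_def)
  then show ?thesis
    by (auto, metis (full_types))
qed

lemma scalar_mult_quad: "scalar d * quad a b s k = quad (d * a) (d * b) s k"
  by (simp add: quad_def scalar_def mult_single algebra_simps)

text \<open>Reversing words exchanges the two terms of each bracket; as \<open>a\<close> is real and
  \<open>b\<close> imaginary, both sides of the relation acquire the factor
  \<open>s\<close>.\<close>

lemma free_star_relator: "free_star (relator \<phi> t k) = scalar (if t then 1 else -1) * relator \<phi> t k"
  by (simp add: relator_def scalar_mult_quad) 
   (simp add: quad_def additive.add[OF additive_free_star[OF additive_id]] single_uminus
    additive.diff[OF additive_free_star[OF additive_id]] algebra_simps)

lemma free_comp_relator: "free_comp n (relator \<phi> t k) = (if n = 2 then relator \<phi> t k else 0)"
  by (simp add: relator_def quad_def additive.add[OF additive_free_comp[OF additive_id]]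
    additive.diff[OF additive_free_comp[OF additive_id]])

lemma alpha_sign_sq: "alpha_sign j \<mu> * alpha_sign j \<mu> = 1"
  by (simp add: alpha_sign_def split: option.split)

text \<open>The signs of the three generators other than \<open>gen None\<close> multiply to 1. As
  \<open>gen None\<close> has sign 1, both sides of a relation are eigenvectors for the same
  eigenvalue.\<close>

lemma alpha_sign_cyclic: "alpha_sign j (Some k) = alpha_sign j (Some (k + 1)) * alpha_sign j (Some (k + 2))"
  using exhaust_3[of j] exhaust_3[of k] by (auto simp: alpha_sign_def)

lemma free_diag_relator:
  "free_diag (alpha_sign j) (relator \<phi> t k) = scalar (alpha_sign j (Some k)) * relator \<phi> t k"
proof -
  have "alpha_sign j None = 1" by (simp add: alpha_sign_def)
  then show ?thesis
    by (simp add: relator_def scalar_mult_quad)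
     (simp add: quad_def additive.add[OF additive_free_diag[OF additive_id]] diag_coeff_def
      additive.diff[OF additive_free_diag[OF additive_id]] alpha_sign_cyclic[of j k] mult_ac)
qed

section \<open>Stability of the ideal under the involution, the signs and the grading\<close>

lemma R4_ideal_eq: "R4_ideal \<phi> = span2 (relations \<phi>)"
  by (simp add: R4_ideal_def genideal_free)

lemma ideal_R4_ideal: "ideal (R4_ideal \<phi>) free_algebra"
  unfolding R4_ideal_eq by (rule ideal_span2)

lemma R4_ideal_zero [simp]: "0 \<in> R4_ideal \<phi>"
  and R4_ideal_add: "p \<in> R4_ideal \<phi> \<Longrightarrow> q \<in> R4_ideal \<phi> \<Longrightarrow> p + q \<in> R4_ideal \<phi>"
  and R4_ideal_mult_left: "q \<in> R4_ideal \<phi> \<Longrightarrow> p * q \<in> R4_ideal \<phi>"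
  and R4_ideal_mult_right: "p \<in> R4_ideal \<phi> \<Longrightarrow> p * q \<in> R4_ideal \<phi>"
  by (simp_all add: R4_ideal_eq span2.intros span2_mult_left span2_mult_right)

lemma R4_ideal_minus: "p \<in> R4_ideal \<phi> \<Longrightarrow> - p \<in> R4_ideal \<phi>"
  using R4_ideal_mult_left[of p \<phi> "-1"] by simp

lemma R4_ideal_diff: "p \<in> R4_ideal \<phi> \<Longrightarrow> q \<in> R4_ideal \<phi> \<Longrightarrow> p - q \<in> R4_ideal \<phi>"
  using R4_ideal_add[of p \<phi> "- q"] R4_ideal_minus[of q \<phi>] by simp

lemma relator_in_R4_ideal: "relator \<phi> t k \<in> R4_ideal \<phi>"
  using free.genideal_self[of "relations \<phi>"] by (auto simp: R4_ideal_def relations_eq)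

lemma R4_ideal_induct [consumes 1, case_names zero add gen]:
  assumes "p \<in> R4_ideal \<phi>"
    and "P 0" "\<And>p q. P p \<Longrightarrow> P q \<Longrightarrow> P (p + q)"
    and "\<And>u a t k v. P (single u a * relator \<phi> t k * single v 1)"
  shows "P p"
  using assms(1) unfolding R4_ideal_eq
  by (induction rule: span2.induct) (use assms(2-) in \<open>auto simp: relations_eq\<close>)

lemma free_star_R4_ideal: "p \<in> R4_ideal \<phi> \<Longrightarrow> free_star p \<in> R4_ideal \<phi>"
  by (induction rule: R4_ideal_induct)
    (simp_all add: additive.zero[OF additive_free_star[OF additive_id]] R4_ideal_add free_star_mult
      additive.add[OF additive_free_star[OF additive_id]] free_star_relator relator_in_R4_ideal
      R4_ideal_mult_left R4_ideal_mult_right del: free_star_single)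

lemma free_diag_R4_ideal: "p \<in> R4_ideal \<phi> \<Longrightarrow> free_diag (alpha_sign j) p \<in> R4_ideal \<phi>"
  by (induction rule: R4_ideal_induct)
    (simp_all add: additive.zero[OF additive_free_diag[OF additive_id]] R4_ideal_add free_diag_mult
      additive.add[OF additive_free_diag[OF additive_id]] free_diag_relator relator_in_R4_ideal
      R4_ideal_mult_left R4_ideal_mult_right del: free_diag_single)

text \<open>A translate u r v is homogeneous of degree \<open>len u + 2 + len v\<close>, so each of
  its components is the whole translate or zero.\<close>

lemma free_comp_R4_ideal: "p \<in> R4_ideal \<phi> \<Longrightarrow> free_comp n p \<in> R4_ideal \<phi>"
proof (induction rule: R4_ideal_induct)
  case (gen u a t k v)
  have "free_comp n (single u a * q * single v 1) =
      (if len u + m + len v = n then single u a * q * single v 1 else 0)" if "free_comp m q = q" for q m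
  proof -
    \<comment> \<open>Inserting the projection turns a claim about homogeneous \<open>q\<close> into
      an identity of additive maps in arbitrary \<open>q\<close>, which can be tested on
      monomials.\<close>
    have "free_comp n (single u a * free_comp m q * single v 1) =
        (if len u + m + len v = n then single u a * free_comp m q * single v 1 else 0)"
      by (rule additive_eqI[of "\<lambda>q. free_comp n (single u a * free_comp m q * single v 1)"])
       (intro additive_intros | auto simp: mult_single additive.zero[OF additive_free_comp[OF additive_id]])+
    then show ?thesis by (simp add: that)
  qed
  from this[of 2 "relator \<phi> t k"] show ?case
    by (simp add: free_comp_relator relator_in_R4_ideal R4_ideal_mult_left R4_ideal_mult_right)
qed (simp_all add: additive.zero[OF additive_free_comp[OF additive_id]]
      additive.add[OF additive_free_comp[OF additive_id]] R4_ideal_add)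


section \<open>Quotients of star-algebras\<close>

lemma star_quot_simps [simp]:
  "carrier (star_quot A I) = a_rcosets\<^bsub>A\<^esub> I" "mult (star_quot A I) = rcoset_mult A I"
  "one (star_quot A I) = I +>\<^bsub>A\<^esub> \<one>\<^bsub>A\<^esub>" "zero (star_quot A I) = I" "add (star_quot A I) = set_add A"
  "smult (star_quot A I) = (\<lambda>c. coset_map A I (\<lambda>a. c \<odot>\<^bsub>A\<^esub> a))"
  "invol (star_quot A I) = coset_map A I (invol A)"
  by (simp_all add: star_quot_def ring.defs FactRing_def)

lemma graded_star_quot_simps [simp]:
  "carrier (graded_star_quot A I) = a_rcosets\<^bsub>A\<^esub> I" "mult (graded_star_quot A I) = rcoset_mult A I"
  "one (graded_star_quot A I) = I +>\<^bsub>A\<^esub> \<one>\<^bsub>A\<^esub>" "zero (graded_star_quot A I) = I"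
  "add (graded_star_quot A I) = set_add A"
  "smult (graded_star_quot A I) = (\<lambda>c. coset_map A I (\<lambda>a. c \<odot>\<^bsub>A\<^esub> a))"
  "invol (graded_star_quot A I) = coset_map A I (invol A)"
  "homog (graded_star_quot A I) n = (\<lambda>a. I +>\<^bsub>A\<^esub> a) ` homog A n"
  by (simp_all add: graded_star_quot_def star_algebra.defs module.defs)

lemma a_rcosets_subset:
  assumes "ring A" "I \<subseteq> carrier A" "C \<in> a_rcosets\<^bsub>A\<^esub> I"
  shows "C \<subseteq> carrier A"
proof -
  interpret ring A by fact
  show ?thesis using assms(2,3) by (auto simp: A_RCOSETS_def' a_r_coset_def')
qed

text \<open>The quotient operations are unions over representatives, and direct images commute with
  unions. The closure hypotheses are explicit because a star-algebra is a mere record.\<close>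

lemma star_iso_quot:
  assumes h: "h \<in> star_iso A B" and A: "ring A" and I: "I \<subseteq> carrier A"
    and closed: "\<And>c a. a \<in> carrier A \<Longrightarrow> c \<odot>\<^bsub>A\<^esub> a \<in> carrier A"
      "\<And>a. a \<in> carrier A \<Longrightarrow> invol A a \<in> carrier A"
  shows "(\<lambda>C. h ` C) \<in> star_iso (star_quot A I) (star_quot B (h ` I))"
    and "a \<in> carrier A \<Longrightarrow> h ` (I +>\<^bsub>A\<^esub> a) = h ` I +>\<^bsub>B\<^esub> h a"
proof -
  interpret ring A by fact
  have iso: "h \<in> ring_iso A B" and smult: "\<And>c a. a \<in> carrier A \<Longrightarrow> h (c \<odot>\<^bsub>A\<^esub> a) = c \<odot>\<^bsub>B\<^esub> h a"
    and star: "\<And>a. a \<in> carrier A \<Longrightarrow> h (invol A a) = invol B (h a)"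
    using h by (auto simp: star_iso_def)
  note hom = ring_iso_memE[OF iso]
  have inj: "inj_on h (carrier A)" and onto: "h ` carrier A = carrier B"
    using hom(5) by (auto simp: bij_betw_def)
  show coset: "h ` (I +>\<^bsub>A\<^esub> a) = h ` I +>\<^bsub>B\<^esub> h a" if "a \<in> carrier A" for a
    using I that by (auto simp: a_r_coset_def' hom(3) subset_iff image_iff)
  have sub: "C \<subseteq> carrier A" if "C \<in> a_rcosets\<^bsub>A\<^esub> I" for C
    using a_rcosets_subset[OF A I that] .
  have map: "h ` coset_map A I f C = coset_map B (h ` I) g (h ` C)"
    if "C \<subseteq> carrier A" "\<And>a. a \<in> carrier A \<Longrightarrow> f a \<in> carrier A"
      "\<And>a. a \<in> carrier A \<Longrightarrow> h (f a) = g (h a)" for C f g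
  proof -
    have "h ` coset_map A I f C = (\<Union>a\<in>C. h ` (I +>\<^bsub>A\<^esub> f a))"
      by (auto simp: coset_map_def)
    also have "\<dots> = (\<Union>a\<in>C. h ` I +>\<^bsub>B\<^esub> g (h a))"
      using that by (auto simp: coset subset_iff)
    finally show ?thesis by (simp add: coset_map_def)
  qed
  have onto_quot: "(`) h ` (a_rcosets\<^bsub>A\<^esub> I) = a_rcosets\<^bsub>B\<^esub> (h ` I)"
    unfolding A_RCOSETS_def' onto[symmetric] by (simp add: image_UN coset)
  have inj_quot: "inj_on ((`) h) (a_rcosets\<^bsub>A\<^esub> I)"
    by (rule inj_onI) (metis inj inj_on_image_eq_iff sub)
  have mult: "h ` rcoset_mult A I C D = rcoset_mult B (h ` I) (h ` C) (h ` D)"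
    if "C \<subseteq> carrier A" "D \<subseteq> carrier A" for C D
  proof -
    have "h ` rcoset_mult A I C D = (\<Union>a\<in>C. \<Union>b\<in>D. h ` (I +>\<^bsub>A\<^esub> (a \<otimes>\<^bsub>A\<^esub> b)))"
      by (auto simp: rcoset_mult_def)
    also have "\<dots> = (\<Union>a\<in>C. \<Union>b\<in>D. h ` I +>\<^bsub>B\<^esub> (h a \<otimes>\<^bsub>B\<^esub> h b))"
      using that by (intro SUP_cong refl) (auto simp: coset hom(2) subset_iff)
    finally show ?thesis by (simp add: rcoset_mult_def)
  qed
  have add: "h ` set_add A C D = set_add B (h ` C) (h ` D)"
    if "C \<subseteq> carrier A" "D \<subseteq> carrier A" for C D
  proof -
    have "h ` set_add A C D = (\<Union>a\<in>C. \<Union>b\<in>D. {h (a \<oplus>\<^bsub>A\<^esub> b)})"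
      by (auto simp: set_add_def')
    also have "\<dots> = (\<Union>a\<in>C. \<Union>b\<in>D. {h a \<oplus>\<^bsub>B\<^esub> h b})"
      using that by (intro SUP_cong refl) (auto simp: hom(3) subset_iff)
    finally show ?thesis by (simp add: set_add_def')
  qed
  have "(`) h \<in> ring_iso (star_quot A I) (star_quot B (h ` I))"
    using onto_quot inj_quot
    by (intro ring_iso_memI) (auto simp: mult add sub coset hom(4) bij_betw_def)
  then show "(\<lambda>C. h ` C) \<in> star_iso (star_quot A I) (star_quot B (h ` I))"
    unfolding star_iso_def by (simp add: map sub closed smult star)
qed

text \<open>The preimage of the ideal on the right is an ideal containing \<open>X\<close>.\<close>

lemma (in ring_hom_ring) genideal_image_subset:
  assumes "X \<subseteq> carrier R"
  shows "h ` (Idl X) \<subseteq> Idl\<^bsub>S\<^esub> (h ` X)"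
proof -
  have "h ` X \<subseteq> carrier S"
    using assms by auto
  then have "ideal {r \<in> carrier R. h r \<in> Idl\<^bsub>S\<^esub> (h ` X)} R" "h ` X \<subseteq> Idl\<^bsub>S\<^esub> (h ` X)"
    using S.genideal_self by (auto intro: ideal_vimage S.genideal_ideal)
  then have "Idl X \<subseteq> {r \<in> carrier R. h r \<in> Idl\<^bsub>S\<^esub> (h ` X)}"
    using assms by (intro R.genideal_minimal) auto
  then show ?thesis by blast
qed

text \<open>One inclusion comes from \<open>h\<close>, the other from its inverse.\<close>

lemma genideal_ring_iso:
  assumes h: "h \<in> ring_iso R S" and R: "ring R" and S: "ring S" and X: "X \<subseteq> carrier R"
  shows "h ` (Idl\<^bsub>R\<^esub> X) = Idl\<^bsub>S\<^esub> (h ` X)"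
proof
  interpret R: ring R by fact
  interpret S: ring S by fact
  interpret h: ring_hom_ring R S h
    by (rule ring_hom_ringI2[OF R S]) (use h in \<open>simp add: ring_iso_def\<close>)
  let ?g = "inv_into (carrier R) h"
  interpret g: ring_hom_ring S R ?g
    by (rule ring_hom_ringI2[OF S R]) (use ring_iso_set_sym[OF R h] in \<open>simp add: ring_iso_def\<close>)
  show "h ` (Idl\<^bsub>R\<^esub> X) \<subseteq> Idl\<^bsub>S\<^esub> (h ` X)"
    by (rule h.genideal_image_subset[OF X])
  have bij: "bij_betw h (carrier R) (carrier S)"
    using h by (simp add: ring_iso_def)
  then have gh: "?g ` h ` X = X"
    using X by (simp add: bij_betw_def inv_into_image_cancel)
  have hX: "h ` X \<subseteq> carrier S"
    using X by auto
  have "?g ` (Idl\<^bsub>S\<^esub> (h ` X)) \<subseteq> Idl\<^bsub>R\<^esub> X"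
    using g.genideal_image_subset[OF hX] by (simp add: gh)
  then have "h ` ?g ` (Idl\<^bsub>S\<^esub> (h ` X)) \<subseteq> h ` (Idl\<^bsub>R\<^esub> X)"
    by blast
  moreover have "Idl\<^bsub>S\<^esub> (h ` X) \<subseteq> h ` carrier R"
    using ideal.Icarr[OF S.genideal_ideal[OF hX]] bij by (auto simp: bij_betw_def)
  ultimately show "Idl\<^bsub>S\<^esub> (h ` X) \<subseteq> h ` (Idl\<^bsub>R\<^esub> X)"
    by (simp add: image_inv_into_cancel[OF refl])
qed

section \<open>The four-planes and their semi-cross products\<close>

abbreviation cls :: "real^3 \<Rightarrow> free \<Rightarrow> free set"
  where "cls \<phi> p \<equiv> R4_ideal \<phi> +>\<^bsub>free_algebra\<^esub> p"

lemma mem_cls: "q \<in> cls \<phi> p \<longleftrightarrow> q - p \<in> R4_ideal \<phi>"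
  by (auto simp: a_r_coset_def' intro: bexI[of _ "q - p"])

lemma cls_eq_iff: "cls \<phi> p = cls \<phi> q \<longleftrightarrow> p - q \<in> R4_ideal \<phi>"
proof
  assume "cls \<phi> p = cls \<phi> q"
  then show "p - q \<in> R4_ideal \<phi>"
    using mem_cls[of p \<phi> p] by (simp add: mem_cls)
next
  assume pq: "p - q \<in> R4_ideal \<phi>"
  show "cls \<phi> p = cls \<phi> q"
  proof (intro equalityI subsetI)
    show "r \<in> cls \<phi> q" if "r \<in> cls \<phi> p" for r
      using R4_ideal_add[OF that[unfolded mem_cls] pq] by (simp add: mem_cls)
    show "r \<in> cls \<phi> p" if "r \<in> cls \<phi> q" for r
      using R4_ideal_diff[OF that[unfolded mem_cls] pq] by (simp add: mem_cls)
  qed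
qed

text \<open>All members of a coset yield the same image coset, so the union collapses to it.\<close>

lemma coset_map_cls:
  assumes "additive h" "\<And>p. p \<in> R4_ideal \<phi> \<Longrightarrow> h p \<in> R4_ideal \<phi>"
  shows "coset_map free_algebra (R4_ideal \<phi>) h (cls \<phi> p) = cls \<phi> (h p)"
proof -
  have "cls \<phi> (h q) = cls \<phi> (h p)" if "q \<in> cls \<phi> p" for q
    using assms(2)[of "q - p"] that by (simp add: mem_cls cls_eq_iff additive.diff[OF assms(1)])
  moreover have "p \<in> cls \<phi> p" by (simp add: mem_cls)
  ultimately show ?thesis
    unfolding coset_map_def by blast
qed

lemma carrier_C_R4: "carrier (C_R4 \<phi>) = range (cls \<phi>)"
  by (auto simp: C_R4_def A_RCOSETS_def')

lemma C_R4_simps [simp]: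
  "cls \<phi> p \<in> carrier (C_R4 \<phi>)"
  "cls \<phi> p \<otimes>\<^bsub>C_R4 \<phi>\<^esub> cls \<phi> q = cls \<phi> (p * q)"
  "cls \<phi> p \<oplus>\<^bsub>C_R4 \<phi>\<^esub> cls \<phi> q = cls \<phi> (p + q)"
  "\<one>\<^bsub>C_R4 \<phi>\<^esub> = cls \<phi> 1"
  "\<zero>\<^bsub>C_R4 \<phi>\<^esub> = cls \<phi> 0"
  "a \<odot>\<^bsub>C_R4 \<phi>\<^esub> cls \<phi> p = cls \<phi> (scalar a * p)"
  "invol (C_R4 \<phi>) (cls \<phi> p) = cls \<phi> (free_star p)"
  "homog (C_R4 \<phi>) n = cls \<phi> ` {p. free_comp n p = p}"
proof -
  interpret ideal "R4_ideal \<phi>" free_algebra by (rule ideal_R4_ideal)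
  show "cls \<phi> p \<in> carrier (C_R4 \<phi>)" by (simp add: carrier_C_R4)
  show "cls \<phi> p \<otimes>\<^bsub>C_R4 \<phi>\<^esub> cls \<phi> q = cls \<phi> (p * q)"
    using rcoset_mult_add[of p q] by (simp add: C_R4_def)
  show "cls \<phi> p \<oplus>\<^bsub>C_R4 \<phi>\<^esub> cls \<phi> q = cls \<phi> (p + q)"
    using a_rcos_sum[of p q] by (simp add: C_R4_def)
  show "\<one>\<^bsub>C_R4 \<phi>\<^esub> = cls \<phi> 1" by (simp add: C_R4_def)
  show "\<zero>\<^bsub>C_R4 \<phi>\<^esub> = cls \<phi> 0"
    by (auto simp: C_R4_def mem_cls)
  show "a \<odot>\<^bsub>C_R4 \<phi>\<^esub> cls \<phi> p = cls \<phi> (scalar a * p)"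
    by (simp add: C_R4_def, rule coset_map_cls) (simp_all add: Modules.additive_def distrib_left R4_ideal_mult_left)
  show "invol (C_R4 \<phi>) (cls \<phi> p) = cls \<phi> (free_star p)"
    by (simp add: C_R4_def, rule coset_map_cls) (intro additive_free_star[OF additive_id] | simp add: free_star_R4_ideal)+
  show "homog (C_R4 \<phi>) n = cls \<phi> ` {p. free_comp n p = p}"
    by (simp add: C_R4_def homog_free)
qed

lemma ring_C_R4: "ring (C_R4 \<phi>)"
proof (intro ringI abelian_groupI monoidI)
  show "\<exists>y\<in>carrier (C_R4 \<phi>). y \<oplus>\<^bsub>C_R4 \<phi>\<^esub> x = \<zero>\<^bsub>C_R4 \<phi>\<^esub>" if "x \<in> carrier (C_R4 \<phi>)" for x
  proof -
    from that obtain p where "x = cls \<phi> p" by (auto simp: carrier_C_R4)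
    then show ?thesis by (intro bexI[of _ "cls \<phi> (- p)"]) simp_all
  qed
qed (auto simp: carrier_C_R4 algebra_simps)

lemma finsum_C_R4: "finite S \<Longrightarrow> (\<Oplus>\<^bsub>C_R4 \<phi>\<^esub>i\<in>S. cls \<phi> (f i)) = cls \<phi> (\<Sum>i\<in>S. f i)"
proof (induction S rule: finite_induct)
  interpret ring "C_R4 \<phi>" by (rule ring_C_R4)
  case (insert i S)
  then show ?case by (subst finsum_insert) auto
next
  interpret ring "C_R4 \<phi>" by (rule ring_C_R4)
  case empty
  show ?case by simp
qed

text \<open>Uniqueness rests on homogeneity of the ideal: a competing decomposition lifts to the
  free algebra up to an element of the ideal, whose components lie in the ideal again.\<close>

lemma hcomp_C_R4: "hcomp (C_R4 \<phi>) (cls \<phi> p) n = cls \<phi> (free_comp n p)"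
proof -
  let ?P = "\<lambda>c. (\<forall>n. c n \<in> homog (C_R4 \<phi>) n) \<and> finite {n. c n \<noteq> \<zero>\<^bsub>C_R4 \<phi>\<^esub>} \<and>
            cls \<phi> p = (\<Oplus>\<^bsub>C_R4 \<phi>\<^esub>n\<in>{n. c n \<noteq> \<zero>\<^bsub>C_R4 \<phi>\<^esub>}. c n)"
  have "(THE c. ?P c) = (\<lambda>n. cls \<phi> (free_comp n p))"
  proof (rule the_equality)
    let ?S = "{n. cls \<phi> (free_comp n p) \<noteq> \<zero>\<^bsub>C_R4 \<phi>\<^esub>}"
    have sub: "?S \<subseteq> degs p"
      using free_comp_eq_0[of _ p] by fastforce
    then have fin: "finite ?S"
      by (rule finite_subset) simp
    \<comment> \<open>The components left out of \<open>?S\<close> are those that vanish in the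
      quotient.\<close>
    have "p - (\<Sum>n\<in>?S. free_comp n p) = (\<Sum>n\<in>degs p - ?S. free_comp n p)"
      by (metis (no_types, lifting) add_diff_cancel_right' sub sum.subset_diff finite_degs sum_free_comp)
    also have "\<dots> \<in> R4_ideal \<phi>"
      using finite_Diff[OF finite_degs, of p ?S]
      by (rule finite_subset_induct[OF _ subset_refl]) (auto simp: cls_eq_iff intro: R4_ideal_add)
    finally have "cls \<phi> p = cls \<phi> (\<Sum>n\<in>?S. free_comp n p)"
      by (simp add: cls_eq_iff)
    with fin show "?P (\<lambda>n. cls \<phi> (free_comp n p))"
      by (simp add: finsum_C_R4 del: C_R4_simps(5))
  next
    fix c assume c: "?P c"
    then have "\<forall>n. \<exists>d. free_comp n d = d \<and> c n = cls \<phi> d"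
      by auto
    then obtain d where d: "\<And>n. free_comp n (d n) = d n" "\<And>n. c n = cls \<phi> (d n)"
      by metis
    let ?S = "{n. c n \<noteq> \<zero>\<^bsub>C_R4 \<phi>\<^esub>}"
    have fin: "finite ?S" using c by blast
    have "cls \<phi> p = cls \<phi> (\<Sum>n\<in>?S. d n)"
      using c finsum_C_R4[OF fin, of \<phi> d] by (simp add: d(2))
    then have diff: "p - (\<Sum>n\<in>?S. d n) \<in> R4_ideal \<phi>"
      by (simp add: cls_eq_iff)
    show "c = (\<lambda>n. cls \<phi> (free_comp n p))"
    proof
      fix m
      have comp_d: "free_comp m (d n) = (if m = n then d n else 0)" for n
        using free_comp_free_comp[of m n "d n"] by (simp add: d(1))
      have "free_comp m p - (if m \<in> ?S then d m else 0) \<in> R4_ideal \<phi>"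
        using free_comp_R4_ideal[OF diff, of m] fin
        by (simp add: additive.diff[OF additive_free_comp[OF additive_id]]
            additive.sum[OF additive_free_comp[OF additive_id]] comp_d)
      then have "cls \<phi> (free_comp m p) = cls \<phi> (if m \<in> ?S then d m else 0)"
        by (simp only: cls_eq_iff)
      \<comment> \<open>Outside \<open>?S\<close> the value of \<open>c\<close> is the zero class,
        in agreement with the default 0.\<close>
      also have "\<dots> = c m"
        by (auto simp: d(2))
      finally show "c m = cls \<phi> (free_comp m p)" ..
    qed
  qed
  then show ?thesis by (simp add: hcomp_def)
qed

lemma hdegs_C_R4: "hdegs (C_R4 \<phi>) (cls \<phi> p) = {n \<in> degs p. free_comp n p \<notin> R4_ideal \<phi>}"
  using free_comp_eq_0[of _ p] by (force simp: hdegs_def hcomp_C_R4 cls_eq_iff)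

text \<open>Replaces the degrees of a class by those of a representative. In both semi-cross
  operations the summand of degree n is obtained from \<open>free_comp n p\<close>, so it vanishes
  in the quotient together with that component.\<close>

lemma finsum_hdegs_C_R4:
  assumes "\<And>n. free_comp n p \<in> R4_ideal \<phi> \<Longrightarrow> f n \<in> R4_ideal \<phi>"
  shows "(\<Oplus>\<^bsub>C_R4 \<phi>\<^esub>n\<in>hdegs (C_R4 \<phi>) (cls \<phi> p). cls \<phi> (f n)) = cls \<phi> (\<Sum>n\<in>degs p. f n)"
proof -
  let ?S = "{n \<in> degs p. free_comp n p \<notin> R4_ideal \<phi>}"
  have "(\<Sum>n\<in>?S. f n) - (\<Sum>n\<in>degs p. f n) = - (\<Sum>n\<in>degs p - ?S. f n)"
    using sum.subset_diff[of ?S "degs p" f] by simp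
  moreover have "(\<Sum>n\<in>degs p - ?S. f n) \<in> R4_ideal \<phi>"
    using finite_Diff[OF finite_degs, of p ?S]
    by (rule finite_subset_induct[OF _ subset_refl]) (auto simp: assms intro: R4_ideal_add)
  ultimately show ?thesis
    by (simp add: hdegs_C_R4 finsum_C_R4 cls_eq_iff R4_ideal_minus)
qed

section \<open>The automorphism and the semi-cross operations on cosets\<close>

lemma alpha_cls: "alpha j \<phi> (cls \<phi> p) = cls \<phi> (free_diag (alpha_sign j) p)"
  unfolding alpha_def
  by (rule coset_map_cls) (intro additive_free_diag[OF additive_id] | simp add: free_diag_R4_ideal)+

lemma alpha_funpow_cls: "(alpha j \<phi> ^^ n) (cls \<phi> p) = cls \<phi> ((free_diag (alpha_sign j) ^^ n) p)"
  by (induction n) (simp_all add: alpha_cls)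

lemma free_diag_funpow_R4_ideal:
  "p \<in> R4_ideal \<phi> \<Longrightarrow> (free_diag (alpha_sign j) ^^ n) p \<in> R4_ideal \<phi>"
  by (induction n) (simp_all add: free_diag_R4_ideal)

lemma free_diag_alpha_sign_involutive: "free_diag (alpha_sign j) (free_diag (alpha_sign j) p) = p"
proof -
  have sq: "diag_coeff (alpha_sign j) w * diag_coeff (alpha_sign j) w = 1" for w
    by (rule diag_coeff_square) (rule alpha_sign_sq)
  show ?thesis
    by (rule additive_eqI[of "\<lambda>p. free_diag (alpha_sign j) (free_diag (alpha_sign j) p)" "\<lambda>p. p"])
      (intro additive_intros | simp add: sq flip: mult.assoc)+
qed

lemma inv_alpha_cls:
  "inv_into (carrier (C_R4 \<phi>)) (alpha j \<phi>) (cls \<phi> p) = cls \<phi> (free_diag (alpha_sign j) p)"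
proof (rule inv_into_f_eq)
  have "alpha j \<phi> (alpha j \<phi> x) = x" if "x \<in> carrier (C_R4 \<phi>)" for x
    using that by (auto simp: carrier_C_R4 alpha_cls free_diag_alpha_sign_involutive)
  then show "inj_on (alpha j \<phi>) (carrier (C_R4 \<phi>))"
    by (rule inj_on_inverseI)
qed (simp_all add: alpha_cls free_diag_alpha_sign_involutive)

lemma inv_alpha_funpow_cls:
  "(inv_into (carrier (C_R4 \<phi>)) (alpha j \<phi>) ^^ n) (cls \<phi> p) = cls \<phi> ((free_diag (alpha_sign j) ^^ n) p)"
  by (induction n) (simp_all add: inv_alpha_cls)

lemma C_R4_semicross_simps [simp]:
  "carrier (C_R4_semicross j \<phi>) = carrier (C_R4 \<phi>)"
  "add (C_R4_semicross j \<phi>) = add (C_R4 \<phi>)"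
  "one (C_R4_semicross j \<phi>) = one (C_R4 \<phi>)"
  "zero (C_R4_semicross j \<phi>) = zero (C_R4 \<phi>)"
  "smult (C_R4_semicross j \<phi>) = smult (C_R4 \<phi>)"
  "homog (C_R4_semicross j \<phi>) = homog (C_R4 \<phi>)"
  by (simp_all add: C_R4_semicross_def semicross_def)

lemma mult_C_R4_semicross [simp]:
  "cls \<phi> p \<otimes>\<^bsub>C_R4_semicross j \<phi>\<^esub> cls \<phi> q = cls \<phi> (twist_mult (alpha_sign j) p q)"
  using finsum_hdegs_C_R4[of p \<phi> "\<lambda>n. free_comp n p * (free_diag (alpha_sign j) ^^ n) q"]
  by (simp add: C_R4_semicross_def semicross_def hcomp_C_R4 alpha_funpow_cls R4_ideal_mult_right
      twist_mult_eq_sum)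

lemma invol_C_R4_semicross [simp]:
  "invol (C_R4_semicross j \<phi>) (cls \<phi> p) = cls \<phi> (twist_star (alpha_sign j) p)"
  using finsum_hdegs_C_R4[of p \<phi> "\<lambda>n. (free_diag (alpha_sign j) ^^ n) (free_star (free_comp n p))"]
  by (simp add: C_R4_semicross_def semicross_def hcomp_C_R4 inv_alpha_funpow_cls twist_star_eq_sum
      free_star_R4_ideal free_diag_funpow_R4_ideal)


section \<open>The substitution and the relations\<close>

definition rho_perm :: "3 \<Rightarrow> ind \<Rightarrow> ind"
  where "rho_perm j \<mu> =
    (case \<mu> of None \<Rightarrow> Some j
     | Some k \<Rightarrow> if k = j then None else if j = 1 then Some k
                 else if k = 1 then Some (if j = 2 then 3 else 2) else Some 1)"

text \<open>Squares leave the signs of the coefficients open. With 1 on \<open>x^0\<close> and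
  \<open>x^j\<close>, the relation at \<open>k = j\<close> fixes, for generic angles, the product of
  the other two: -1 when these generators stay in place, 1 when they are exchanged. Hence one
  \<open>- \<i>\<close> for \<open>j = 2\<close> and \<open>j = 3\<close>.\<close>

definition rho_coeff :: "3 \<Rightarrow> ind \<Rightarrow> complex"
  where "rho_coeff j \<mu> =
    (case \<mu> of None \<Rightarrow> 1
     | Some k \<Rightarrow> if k = j then 1 else if j = 2 \<and> k = 3 \<or> j = 3 \<and> k = 2 then - \<i> else \<i>)"

lemma rep_sign_sq: "rep_sign n \<mu> * rep_sign n \<mu> = 1"
  by (auto simp: rep_sign_def power_int_mult_distrib[symmetric] split: option.split)

lemma twist_rho: "twist (alpha_sign j) (\<lambda>\<mu>. rep_sign n \<mu> * rho_coeff j \<mu>) (rho_perm j)"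
proof
  fix \<mu>
  show "alpha_sign j \<mu> = 1 \<or> alpha_sign j \<mu> = - 1"
    by (auto simp: alpha_sign_def split: option.split)
  show "rho_perm j (rho_perm j \<mu>) = \<mu>" "alpha_sign j (rho_perm j \<mu>) = alpha_sign j \<mu>"
    using exhaust_3[of j] exhaust_3[of "the \<mu>"]
    by (cases \<mu>; auto simp: rho_perm_def alpha_sign_def)+
  have "rho_coeff j \<mu> * rho_coeff j \<mu> = alpha_sign j \<mu>"
    using exhaust_3[of j] by (auto simp: rho_coeff_def alpha_sign_def split: option.splits)
  then show "rep_sign n \<mu> * rho_coeff j \<mu> * (rep_sign n \<mu> * rho_coeff j \<mu>) = alpha_sign j \<mu>"
    using rep_sign_sq[of n \<mu>] by (metis mult.assoc mult.left_commute mult_1)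
qed

lemma (in twist) twist_subst_quad:
  "twist_subst (quad a b s k) =
    single (Word [\<pi> None, \<pi> (Some k)]) (c None * \<epsilon> (Some k) * c (Some k) * a)
    + single (Word [\<pi> (Some k), \<pi> None]) (c (Some k) * \<epsilon> None * c None * (s * a))
    - single (Word [\<pi> (Some (k + 1)), \<pi> (Some (k + 2))])
        (c (Some (k + 1)) * \<epsilon> (Some (k + 2)) * c (Some (k + 2)) * b)
    + single (Word [\<pi> (Some (k + 2)), \<pi> (Some (k + 1))])
        (c (Some (k + 2)) * \<epsilon> (Some (k + 1)) * c (Some (k + 1)) * (s * b))"
  by (simp add: quad_def perm_word_def additive.add[OF additive_twist_subst[OF additive_id]]
      additive.diff[OF additive_twist_subst[OF additive_id]] mult_ac)

lemma twist_rho0: "twist (alpha_sign j) (rho_coeff j) (rho_perm j)"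
proof -
  have "rep_sign 0 \<mu> = 1" for \<mu>
    by (simp add: rep_sign_def split: option.split)
  then show ?thesis
    using twist_rho[of j 0] by simp
qed

lemma sin_cos_rep_sign:
  assumes "x = y + of_int n * pi"
  shows "sin x = (-1) powi n * sin y" "cos x = (-1) powi n * cos y"
proof -
  have "sin (of_int n * pi) = 0" "cos (of_int n * pi) = (-1) powi n"
    using sin_npi_int[of n] cos_npi_int[of n]
    by (simp_all add: mult.commute power_int_minus_left)
  then show "sin x = (-1) powi n * sin y" "cos x = (-1) powi n * cos y"
    by (simp_all add: assms sin_add cos_add)
qed

lemma numeral_3_reduce [simp]: "(4::3) = 1" "(5::3) = 2"
  by simp_all

text \<open>For \<open>k = j\<close> the two sides of the relation keep their places; otherwise they
  are interchanged, up to factors of \<open>\<i>\<close>. Sines of single angles must then match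
  cosines of differences, which is the origin of the shifts by \<open>pi/2\<close> in
  \<open>f_map\<close>.\<close>

lemma twist_subst_quad_rho:
  defines "T \<equiv> \<lambda>j. twist.twist_subst (alpha_sign j) (rho_coeff j) (rho_perm j)"
  assumes "s = 1 \<or> s = -1"
  shows "T 1 (quad a b s 1) = quad (s * a) b s 1"
    "T 1 (quad a b s 2) = quad (- \<i> * s * b) (\<i> * a) s 3"
    "T 1 (quad a b s 3) = quad (\<i> * b) (- \<i> * s * a) s 2"
    "T 2 (quad a b s 1) = quad (- \<i> * b) (\<i> * a) s 1"
    "T 2 (quad a b s 2) = quad (s * a) (s * b) s 2"
    "T 2 (quad a b s 3) = quad (- \<i> * s * b) (\<i> * s * a) s 3"
    "T 3 (quad a b s 1) = quad (\<i> * s * b) (- \<i> * s * a) s 1"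
    "T 3 (quad a b s 2) = quad (\<i> * b) (- \<i> * a) s 2"
    "T 3 (quad a b s 3) = quad (s * a) (s * b) s 3"
  using assms(2) unfolding T_def
  by (auto simp: twist.twist_subst_quad[OF twist_rho0] rho_perm_def rho_coeff_def alpha_sign_def)
    (simp_all add: quad_def single_uminus mult.assoc flip: mult.assoc[of \<i> \<i>])

lemma uminus_quad: "- quad a b s k = quad (- a) (- b) s k"
  by (simp add: quad_def single_uminus)

text \<open>Relation k pairs the indices as {0,k} and {l,m}. A product of two disjoint
  transpositions preserves all three pairings (\<open>j = 2, 3\<close>); the single transposition
  for \<open>j = 1\<close> exchanges two of them.\<close>

definition rho_ind :: "3 \<Rightarrow> 3 \<Rightarrow> 3"
  where "rho_ind j k = (if j = 1 \<and> k = 2 then 3 else if j = 1 \<and> k = 3 then 2 else k)"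

lemma rho_ind_rho_ind: "rho_ind j (rho_ind j k) = k"
  by (simp add: rho_ind_def)

text \<open>The formulas for \<open>f_map\<close> enter here, through the addition theorems.\<close>

lemma twist_subst_relator_f_map:
  defines "T \<equiv> \<lambda>j. twist.twist_subst (alpha_sign j) (rho_coeff j) (rho_perm j)"
  shows "T j (relator (f_map j \<phi>) t k) \<in> {relator \<phi> t (rho_ind j k), - relator \<phi> t (rho_ind j k)}"
  using exhaust_3[of j] exhaust_3[of k]
  by (elim disjE; hypsubst; cases t; simp add: relator_def T_def twist_subst_quad_rho f_map_def rho_ind_def
      uminus_quad sin_diff cos_diff sin_add cos_add algebra_simps)

text \<open>Shifting angles by multiples of pi multiplies \<open>a\<close> by the sign of k and
  \<open>b\<close> by those of l and m. The coefficients of the substitution contribute the same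
  signs again, and they cancel.\<close>

lemma twist_subst_relator:
  fixes n :: "int^3"
  defines "T \<equiv> \<lambda>j. twist.twist_subst (alpha_sign j) (\<lambda>\<mu>. rep_sign n \<mu> * rho_coeff j \<mu>) (rho_perm j)"
  assumes \<psi>: "\<And>k. \<psi>$k = f_map j \<phi> $ k + of_int (n$k) * pi"
  shows "T j (relator \<psi> t k) \<in> {relator \<phi> t (rho_ind j k), - relator \<phi> t (rho_ind j k)}"
proof -
  let ?T0 = "twist.twist_subst (alpha_sign j) (rho_coeff j) (rho_perm j)"
  let ?s = "\<lambda>k. rep_sign n (Some k)"
  have sq: "?s k * (?s k * z) = z" for k z
    using rep_sign_sq[of n "Some k"] by (simp flip: mult.assoc)
  have none: "rep_sign n None = 1"
    by (simp add: rep_sign_def)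
  have rep: "complex_of_real ((-1) powi (n$k)) = ?s k" for k
    by (simp add: rep_sign_def of_real_power_int)
  have trig: "complex_of_real (sin (\<psi>$k)) = ?s k * sin (f_map j \<phi> $ k)"
    "complex_of_real (cos (\<psi>$k)) = ?s k * cos (f_map j \<phi> $ k)" for k
    using sin_cos_rep_sign[OF \<psi>[of k]] by (simp_all flip: rep)
  have "T j (quad (?s k * a) (?s (k + 1) * ?s (k + 2) * b) s k) = ?T0 (quad a b s k)" for a b s
    by (simp add: T_def twist.twist_subst_quad[OF twist_rho] twist.twist_subst_quad[OF twist_rho0] none)
      (simp add: mult_ac sq)
  moreover have "relator \<psi> t k = (if t then
      quad (?s k * sin (f_map j \<phi> $ k))
        (?s (k + 1) * ?s (k + 2) * (\<i> * cos (f_map j \<phi> $ (k + 1) - f_map j \<phi> $ (k + 2)))) 1 k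
    else quad (?s k * cos (f_map j \<phi> $ k))
        (?s (k + 1) * ?s (k + 2) * (\<i> * sin (f_map j \<phi> $ (k + 1) - f_map j \<phi> $ (k + 2)))) (-1) k)"
    by (simp add: relator_def sin_diff cos_diff trig algebra_simps)
  ultimately have "T j (relator \<psi> t k) = ?T0 (relator (f_map j \<phi>) t k)"
    by (simp add: relator_def)
  then show ?thesis
    using twist_subst_relator_f_map[of j \<phi> t k] by simp
qed

section \<open>Translates of relations and the image of the ideal\<close>

lemma scalar_mult_scalar: "scalar a * (scalar b * p) = scalar (a * b) * p"
  by (simp add: scalar_def mult_single flip: mult.assoc)

lemma scalar_one [simp]: "scalar 1 = 1" and scalar_minus_one: "scalar (-1) * p = - p"
  by (simp_all add: scalar_def single_uminus)

lemma mult_scalar: "p * (scalar a * q) = scalar a * (p * q)"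
  by (metis mult.assoc scalar_def single_zero_central)

lemma single_eq_scalar_mult: "single w a = scalar a * single w 1"
  by (simp add: scalar_def mult_single)

lemma free_diag_scalar_mult: "free_diag \<epsilon> (scalar a * p) = scalar a * free_diag \<epsilon> p"
  unfolding free_diag_mult by (simp add: scalar_def diag_coeff_def)

lemma free_diag_funpow_eigen:
  assumes "free_diag \<epsilon> p = scalar e * p"
  shows "(free_diag \<epsilon> ^^ n) (scalar a * p) = scalar (a * e ^ n) * p"
  by (induction n) (simp_all add: assms free_diag_scalar_mult scalar_mult_scalar mult_ac)

text \<open>A relation has degree two and the automorphism is an involution, so the right factor is
  left unchanged.\<close>

lemma (in twist) twist_mult_relator: "twist_mult \<epsilon> (relator \<phi> t k) q = relator \<phi> t k * q"
proof -
  have sq: "free_diag \<epsilon> (free_diag \<epsilon> q) = q"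
    by (rule additive_eqI[of "\<lambda>q. free_diag \<epsilon> (free_diag \<epsilon> q)"])
      (intro additive_intros | simp flip: mult.assoc)+
  have "twist_mult \<epsilon> (quad a b s k) q = quad a b s k * q" for a b s
    by (simp add: quad_def additive.add[OF additive_twist_mult1[OF additive_id]] sq algebra_simps
        additive.diff[OF additive_twist_mult1[OF additive_id]] numeral_2_eq_2)
  then show ?thesis by (simp add: relator_def)
qed

text \<open>The twist caused by \<open>u\<close> falls on relation times word, an eigenvector, and
  so costs only a sign; the relation itself causes none. That \<open>d\<close> is nonzero and
  independent of \<open>a\<close> allows a prescribed translate to be hit.\<close>

lemma (in twist) twist_subst_translated_relator:
  assumes eps: "\<epsilon> = alpha_sign j"
    and rel: "twist_subst r \<in> {relator \<phi> t k, - relator \<phi> t k}"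
  obtains d where "d \<noteq> 0" "\<And>a. twist_subst (single u a * r * single v 1) =
      single (perm_word u) (d * a) * relator \<phi> t k * single (perm_word v) 1"
proof -
  define y where "y = relator \<phi> t k * single (perm_word v) 1"
  have y: "free_diag \<epsilon> y = scalar (alpha_sign j (Some k) * diag_coeff \<epsilon> v) * y"
  proof -
    have "free_diag \<epsilon> (relator \<phi> t k) = scalar (alpha_sign j (Some k)) * relator \<phi> t k"
      unfolding eps by (rule free_diag_relator)
    then have "free_diag \<epsilon> y = scalar (alpha_sign j (Some k)) * relator \<phi> t k * (scalar (diag_coeff \<epsilon> v) * single (perm_word v) 1)"
      by (simp add: y_def free_diag_mult flip: single_eq_scalar_mult)
    then show ?thesis
      by (simp add: y_def mult.assoc mult_scalar[of "relator \<phi> t k"] scalar_mult_scalar)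
  qed
  obtain e where e: "e \<noteq> 0" "twist_subst r = scalar e * relator \<phi> t k"
    using rel that[of 1] that[of "-1"] scalar_minus_one[of "relator \<phi> t k"] by force
  have "twist_mult \<epsilon> (scalar e * relator \<phi> t k) q = scalar e * relator \<phi> t k * q" for q
  proof -
    have "twist_mult \<epsilon> (scalar e * p) q = scalar e * twist_mult \<epsilon> p q" for p
      by (rule additive_eqI[of "\<lambda>p. twist_mult \<epsilon> (scalar e * p) q"])
        (intro additive_intros | simp add: scalar_def mult_single flip: mult.assoc)+
    then show ?thesis by (simp add: twist_mult_relator mult.assoc)
  qed
  then have right: "twist_subst (r * single v 1) = scalar (e * twist_coeff (letters v)) * y"
    unfolding twist_subst_mult e twist_subst_single
    by (subst single_eq_scalar_mult) (simp add: y_def mult.assoc mult_scalar[of "relator \<phi> t k"] scalar_mult_scalar)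
  \<comment> \<open>Besides the coefficients of \<open>u\<close>, \<open>r\<close> and
    \<open>v\<close>, the eigenvalue occurs once for each letter of \<open>u\<close>.\<close>
  define d where "d = twist_coeff (letters u) *
    (e * twist_coeff (letters v) * (alpha_sign j (Some k) * diag_coeff \<epsilon> v) ^ len u)"
  have "twist_subst (single u a * r * single v 1) = single (perm_word u) (d * a) * relator \<phi> t k * single (perm_word v) 1" for a
  proof -
    have "twist_subst (single u a * r * single v 1) = twist_mult \<epsilon> (twist_subst (single u a)) (twist_subst (r * single v 1))"
      by (simp only: mult.assoc twist_subst_mult)
    also have "\<dots> = single (perm_word u) (twist_coeff (letters u) * a) *
        (scalar (e * twist_coeff (letters v) * (alpha_sign j (Some k) * diag_coeff \<epsilon> v) ^ len u) * y)"
      by (simp add: right free_diag_funpow_eigen[OF y])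
    also have "\<dots> = single (perm_word u) (d * a) * y"
      by (simp add: d_def scalar_def mult_single mult_ac flip: mult.assoc[of "single _ _" "single _ _"])
    finally show ?thesis by (simp add: y_def mult.assoc)
  qed
  moreover have "d \<noteq> 0"
  proof -
    have "alpha_sign j (Some k) \<noteq> 0" "diag_coeff \<epsilon> v \<noteq> 0"
      using eps_nonzero[of "Some k"] diag_coeff_sq[of v] by (auto simp: eps)
    with e(1) show ?thesis by (simp add: d_def)
  qed
  ultimately show ?thesis by (rule that[rotated])
qed

text \<open>Since \<open>f\<close> is an involution, the relation \<open>k\<close> at
  \<open>\<phi>\<close> comes from the relation \<open>f k\<close> at \<open>\<psi>\<close>; this
  gives surjectivity.\<close>

lemma (in twist) twist_subst_R4_ideal:
  assumes eps: "\<epsilon> = alpha_sign j"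
    and rel: "\<And>t k. twist_subst (relator \<psi> t k) \<in> {relator \<phi> t (f k), - relator \<phi> t (f k)}"
    and f: "\<And>k. f (f k) = k"
  shows "twist_subst ` R4_ideal \<psi> = R4_ideal \<phi>"
proof (intro equalityI subsetI)
  fix p assume "p \<in> twist_subst ` R4_ideal \<psi>"
  then obtain q where q: "q \<in> R4_ideal \<psi>" "p = twist_subst q" by blast
  from q(1) have "twist_subst q \<in> R4_ideal \<phi>"
  proof (induction rule: R4_ideal_induct)
    case (gen u a t k v)
    show ?case
      by (rule twist_subst_translated_relator[OF eps rel[of t k], of u v])
        (simp add: relator_in_R4_ideal R4_ideal_mult_left R4_ideal_mult_right)
  qed (simp_all add: additive.zero[OF additive_twist_subst[OF additive_id]]
    additive.add[OF additive_twist_subst[OF additive_id]] R4_ideal_add)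
  with q show "p \<in> R4_ideal \<phi>" by simp
next
  fix p assume "p \<in> R4_ideal \<phi>"
  then show "p \<in> twist_subst ` R4_ideal \<psi>"
  proof (induction rule: R4_ideal_induct)
    case zero
    then show ?case
      by (rule image_eqI[of _ _ 0]) (simp_all add: additive.zero[OF additive_twist_subst[OF additive_id]])
  next
    case (add p q)
    then obtain p' q' where "p' \<in> R4_ideal \<psi>" "q' \<in> R4_ideal \<psi>" "p = twist_subst p'" "q = twist_subst q'"
      by blast
    then show ?case
      by (intro image_eqI[of _ _ "p' + q'"])
        (simp_all add: additive.add[OF additive_twist_subst[OF additive_id]] R4_ideal_add)
  next
    case (gen u a t k v)
    obtain d where d: "d \<noteq> 0"
      "\<And>b. twist_subst (single (perm_word u) b * relator \<psi> t (f k) * single (perm_word v) 1) =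
        single u (d * b) * relator \<phi> t k * single v 1"
      using twist_subst_translated_relator[OF eps rel[of t "f k"], of "perm_word u" "perm_word v"]
      by (auto simp: f)
    show ?case
      by (rule image_eqI[of _ _ "single (perm_word u) (a / d) * relator \<psi> t (f k) * single (perm_word v) 1"])
        (use d in \<open>simp_all add: relator_in_R4_ideal R4_ideal_mult_left R4_ideal_mult_right\<close>)
  qed
qed

section \<open>The sum of squares and the isomorphisms of the quotients\<close>

lemma (in twist) twist_subst_scalar_mult: "twist_subst (scalar a * p) = scalar a * twist_subst p"
  unfolding twist_subst_mult by (simp add: scalar_def perm_word_def zero_word_def)

lemma (in twist) twist_subst_gen: "twist_subst (gen \<mu>) = scalar (c \<mu>) * gen (\<pi> \<mu>)"
  by (simp add: gen_def scalar_def perm_word_def mult_single)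

text \<open>A square acquires the factor \<open>c\<close> squared times its sign, which is 1, and
  \<open>\<pi>\<close> only permutes the summands.\<close>

lemma (in twist) twist_subst_sum_squares: "twist_subst (\<Sum>\<mu>\<in>UNIV. gen \<mu> * gen \<mu>) = (\<Sum>\<mu>\<in>UNIV. gen \<mu> * gen \<mu>)"
proof -
  have "c \<mu> * (\<epsilon> \<mu> * c \<mu>) = 1" for \<mu>
    using coeff_sq[of \<mu>] eps_sq[of \<mu>] by (metis mult.left_commute)
  then have "twist_subst (gen \<mu> * gen \<mu>) = gen (\<pi> \<mu>) * gen (\<pi> \<mu>)" for \<mu>
    by (simp add: gen_def mult_single perm_word_def mult.assoc)
  moreover have "bij \<pi>"
    by (rule bij_betw_byWitness[of _ \<pi>]) auto
  ultimately show ?thesis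
    using sum.reindex_bij_betw[of \<pi> UNIV UNIV "\<lambda>\<mu>. gen \<mu> * gen \<mu>"]
    by (simp add: additive.sum[OF additive_twist_subst[OF additive_id]])
qed

lemma sum_sq_eq: "sum_sq \<phi> = cls \<phi> (\<Sum>\<mu>\<in>UNIV. gen \<mu> * gen \<mu>)"
  by (simp add: sum_sq_def xgen_def finsum_C_R4)

lemma (in twist) graded_star_iso_twist:
  assumes eps: "\<epsilon> = alpha_sign j" and ideal: "twist_subst ` R4_ideal \<psi> = R4_ideal \<phi>"
  shows "(`) twist_subst \<in> graded_star_iso (C_R4 \<psi>) (C_R4_semicross j \<phi>)" (is ?iso)
    and "twist_subst ` cls \<psi> p = cls \<phi> (twist_subst p)" (is ?cls)
proof -
  have cls: "twist_subst ` cls \<psi> p = cls \<phi> (twist_subst p)" for p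
    unfolding ideal[symmetric]
    by (simp add: a_r_coset_def' image_UN additive.add[OF additive_twist_subst[OF additive_id]])
  then show ?cls .
  note inj = bij_is_inj[OF bij_twist_subst] and surj = bij_is_surj[OF bij_twist_subst]
  have one: "twist_subst 1 = 1"
    using twist_subst_single[of 0 1] by (simp add: perm_word_def zero_word_def flip: single_one)
  have image: "(`) twist_subst ` cls \<psi> ` X = cls \<phi> ` twist_subst ` X" for X
    by (simp add: image_image cls)
  have bij: "bij_betw ((`) twist_subst) (carrier (C_R4 \<psi>)) (carrier (C_R4_semicross j \<phi>))"
    unfolding bij_betw_def carrier_C_R4 C_R4_semicross_simps(1) image surj
    using inj by (auto intro!: inj_onI simp: inj_image_eq_iff)
  have semicross:
    "cls \<phi> p \<otimes>\<^bsub>C_R4_semicross j \<phi>\<^esub> cls \<phi> q = cls \<phi> (twist_mult \<epsilon> p q)"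
    "invol (C_R4_semicross j \<phi>) (cls \<phi> p) = cls \<phi> (twist_star \<epsilon> p)" for p q
    by (simp_all add: eps)
  have "(`) twist_subst \<in> ring_iso (C_R4 \<psi>) (C_R4_semicross j \<phi>)"
  proof (rule ring_iso_memI[OF _ _ _ _ bij])
    fix C D assume D: "D \<in> carrier (C_R4 \<psi>)" and "C \<in> carrier (C_R4 \<psi>)"
    then obtain p q where [simp]: "C = cls \<psi> p" "D = cls \<psi> q"
      by (auto simp: carrier_C_R4)
    show "twist_subst ` (C \<otimes>\<^bsub>C_R4 \<psi>\<^esub> D) = twist_subst ` C \<otimes>\<^bsub>C_R4_semicross j \<phi>\<^esub> twist_subst ` D"
      "twist_subst ` (C \<oplus>\<^bsub>C_R4 \<psi>\<^esub> D) = twist_subst ` C \<oplus>\<^bsub>C_R4_semicross j \<phi>\<^esub> twist_subst ` D"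
      by (simp_all add: cls twist_subst_mult semicross additive.add[OF additive_twist_subst[OF additive_id]]
          del: mult_C_R4_semicross)
  qed (use bij in \<open>auto simp: bij_betw_def cls one\<close>)
  moreover have "twist_subst ` (a \<odot>\<^bsub>C_R4 \<psi>\<^esub> C) = a \<odot>\<^bsub>C_R4_semicross j \<phi>\<^esub> (twist_subst ` C)"
    "twist_subst ` invol (C_R4 \<psi>) C = invol (C_R4_semicross j \<phi>) (twist_subst ` C)"
    if C: "C \<in> carrier (C_R4 \<psi>)" for a C
  proof -
    obtain p where [simp]: "C = cls \<psi> p"
      using C by (auto simp: carrier_C_R4)
    show "twist_subst ` (a \<odot>\<^bsub>C_R4 \<psi>\<^esub> C) = a \<odot>\<^bsub>C_R4_semicross j \<phi>\<^esub> (twist_subst ` C)"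
      "twist_subst ` invol (C_R4 \<psi>) C = invol (C_R4_semicross j \<phi>) (twist_subst ` C)"
      by (simp_all add: cls semicross twist_subst_scalar_mult twist_subst_star del: invol_C_R4_semicross)
  qed
  ultimately have "(`) twist_subst \<in> star_iso (C_R4 \<psi>) (C_R4_semicross j \<phi>)"
    by (simp add: star_iso_def)
  moreover have "twist_subst ` {p. free_comp n p = p} = {p. free_comp n p = p}" for n
  proof (intro equalityI subsetI)
    fix q assume q: "q \<in> {p. free_comp n p = p}"
    obtain p where p: "q = twist_subst p" using surj by blast
    with q have "free_comp n p = p"
      using inj by (simp add: free_comp_twist_subst inj_eq)
    with p show "q \<in> twist_subst ` {p. free_comp n p = p}" by blast
  qed (auto simp: free_comp_twist_subst)
  ultimately show ?iso
    by (simp add: graded_star_iso_def image)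
qed

text \<open>The isomorphism carries the generator of one sphere ideal to that of the other. The ring
  laws of the semi-cross product are inherited from \<open>C_R4 \<psi>\<close> through
  \<open>h\<close>.\<close>

lemma sphere_star_iso:
  assumes h: "h \<in> graded_star_iso (C_R4 \<psi>) (C_R4_semicross j \<phi>)" and sum_sq: "h (sum_sq \<psi>) = sum_sq \<phi>"
  shows "\<exists>\<sigma> \<in> star_iso (C_S3 \<psi>) (C_S3_semicross j \<phi>).
            \<forall>a \<in> carrier (C_R4 \<psi>).
              \<sigma> (sphere_ideal (C_R4 \<psi>) (sum_sq \<psi>) +>\<^bsub>C_R4 \<psi>\<^esub> a) =
              sphere_ideal (C_R4_semicross j \<phi>) (sum_sq \<phi>) +>\<^bsub>C_R4_semicross j \<phi>\<^esub> h a"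
proof -
  let ?A = "C_R4 \<psi>" and ?B = "C_R4_semicross j \<phi>"
  have star: "h \<in> star_iso ?A ?B" and iso: "h \<in> ring_iso ?A ?B"
    using h by (auto simp: graded_star_iso_def star_iso_def)
  interpret A: ring ?A by (rule ring_C_R4)
  interpret phi: ring "C_R4 \<phi>" by (rule ring_C_R4)
  \<comment> \<open>The transported ring has the image of zero as its zero. This image is idempotent
    for the addition shared with \<open>C_R4 \<phi>\<close>, hence it is the zero of the semi-cross
    product.\<close>
  have "h \<zero>\<^bsub>?A\<^esub> \<in> carrier (C_R4 \<phi>)" "h \<zero>\<^bsub>?A\<^esub> \<oplus>\<^bsub>C_R4 \<phi>\<^esub> h \<zero>\<^bsub>?A\<^esub> = h \<zero>\<^bsub>?A\<^esub>"
    using ring_iso_memE(1,3)[OF iso, of "\<zero>\<^bsub>?A\<^esub>"] by (metis A.zero_closed A.l_zero C_R4_semicross_simps(1,2))+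
  then have "h \<zero>\<^bsub>?A\<^esub> = \<zero>\<^bsub>?B\<^esub>"
    by (metis C_R4_semicross_simps(4) phi.add.l_cancel_one)
  then have ring_B: "ring ?B"
    using A.ring_iso_imp_img_ring[OF iso] by (simp del: C_R4_simps C_R4_semicross_simps)
  interpret B: ring ?B by (rule ring_B)
  interpret hom: ring_hom_ring ?A ?B h
    by (rule ring_hom_ringI2[OF A.ring_axioms ring_B]) (use iso in \<open>simp add: ring_iso_def\<close>)
  have r: "sum_sq \<psi> \<in> carrier ?A"
    by (simp add: sum_sq_eq)
  have "h (sum_sq \<psi> \<ominus>\<^bsub>?A\<^esub> \<one>\<^bsub>?A\<^esub>) = sum_sq \<phi> \<ominus>\<^bsub>?B\<^esub> \<one>\<^bsub>?B\<^esub>"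
    unfolding a_minus_def using r by (simp add: sum_sq del: C_R4_simps C_R4_semicross_simps)
  then have sphere: "h ` sphere_ideal ?A (sum_sq \<psi>) = sphere_ideal ?B (sum_sq \<phi>)"
    unfolding sphere_ideal_def using genideal_ring_iso[OF iso A.ring_axioms ring_B] r by simp
  have sub: "sphere_ideal ?A (sum_sq \<psi>) \<subseteq> carrier ?A"
    using additive_subgroup.a_subset[OF ideal.axioms(1)[OF A.genideal_ideal]] r
    by (simp add: sphere_ideal_def)
  have "a \<odot>\<^bsub>?A\<^esub> C \<in> carrier ?A" "invol ?A C \<in> carrier ?A" if "C \<in> carrier ?A" for a C
    using that by (auto simp only: carrier_C_R4 C_R4_simps)
  then have quot: "(`) h \<in> star_iso (star_quot ?A (sphere_ideal ?A (sum_sq \<psi>)))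
        (star_quot ?B (sphere_ideal ?B (sum_sq \<phi>)))"
    "a \<in> carrier ?A \<Longrightarrow> h ` (sphere_ideal ?A (sum_sq \<psi>) +>\<^bsub>?A\<^esub> a) = sphere_ideal ?B (sum_sq \<phi>) +>\<^bsub>?B\<^esub> h a"
    for a
    using star_iso_quot[OF star A.ring_axioms sub] by (simp_all add: sphere)
  show ?thesis
    unfolding C_S3_def C_S3_semicross_def
    by (intro bexI[of _ "(`) h"] ballI quot)
qed

text \<open>Canonicity is expressed by choosing \<open>M\<close> before the angles: the values on
  generators depend on \<open>j\<close> alone, up to the signs of the representative. Letting
  \<open>\<psi>\<close> range over all representatives makes the result one about classes modulo
  pi.\<close>

theorem proposition7p3:
  fixes j :: 3
  shows "\<exists>M :: ind \<Rightarrow> ind \<Rightarrow> complex.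
    \<forall>(\<phi> :: real^3) (\<psi> :: real^3) (n :: int^3).
      (\<forall>k. \<psi>$k = f_map j \<phi> $ k + of_int (n$k) * pi) \<longrightarrow>
      (\<exists>\<rho> \<in> graded_star_iso (C_R4 \<psi>) (C_R4_semicross j \<phi>).
         (\<forall>\<mu>. \<rho> (xgen \<psi> \<mu>) =
            (\<Oplus>\<^bsub>C_R4 \<phi>\<^esub>\<nu>\<in>UNIV. (rep_sign n \<mu> * M \<mu> \<nu>) \<odot>\<^bsub>C_R4 \<phi>\<^esub> xgen \<phi> \<nu>)) \<and>
         \<rho> (sum_sq \<psi>) = sum_sq \<phi> \<and>
         (\<exists>\<sigma> \<in> star_iso (C_S3 \<psi>) (C_S3_semicross j \<phi>).
            \<forall>a \<in> carrier (C_R4 \<psi>).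
              \<sigma> (sphere_ideal (C_R4 \<psi>) (sum_sq \<psi>) +>\<^bsub>C_R4 \<psi>\<^esub> a) =
              sphere_ideal (C_R4_semicross j \<phi>) (sum_sq \<phi>) +>\<^bsub>C_R4_semicross j \<phi>\<^esub> \<rho> a))"
\<comment> \<open>The witness is the monomial matrix of \<open>rho_perm\<close> with entries
  \<open>rho_coeff\<close>, which do not involve the angles.\<close>
proof (intro exI[of _ "\<lambda>\<mu> \<nu>. if \<nu> = rho_perm j \<mu> then rho_coeff j \<mu> else 0"] allI impI)
  fix \<phi> \<psi> :: "real^3" and n :: "int^3"
  assume \<psi>: "\<forall>k. \<psi>$k = f_map j \<phi> $ k + of_int (n$k) * pi"
  interpret T: twist "alpha_sign j" "\<lambda>\<mu>. rep_sign n \<mu> * rho_coeff j \<mu>" "rho_perm j"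
    by (rule twist_rho)
  have ideal: "T.twist_subst ` R4_ideal \<psi> = R4_ideal \<phi>"
    using \<psi> by (intro T.twist_subst_R4_ideal[of j _ _ "rho_ind j"] twist_subst_relator rho_ind_rho_ind) auto
  note iso = T.graded_star_iso_twist(1)[OF refl ideal] and cls = T.graded_star_iso_twist(2)[OF refl ideal]
  have sum_sq: "T.twist_subst ` sum_sq \<psi> = sum_sq \<phi>"
    by (simp add: sum_sq_eq cls T.twist_subst_sum_squares)
  have "T.twist_subst ` xgen \<psi> \<mu> =
      (\<Oplus>\<^bsub>C_R4 \<phi>\<^esub>\<nu>\<in>UNIV.
        (rep_sign n \<mu> * (if \<nu> = rho_perm j \<mu> then rho_coeff j \<mu> else 0)) \<odot>\<^bsub>C_R4 \<phi>\<^esub> xgen \<phi> \<nu>)" for \<mu>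
  proof -
    have "(\<Sum>\<nu>\<in>UNIV. scalar (rep_sign n \<mu> * (if \<nu> = rho_perm j \<mu> then rho_coeff j \<mu> else 0)) * gen \<nu>) =
        (\<Sum>\<nu>\<in>UNIV. if \<nu> = rho_perm j \<mu> then scalar (rep_sign n \<mu> * rho_coeff j \<mu>) * gen \<nu> else 0)"
      by (intro sum.cong) (auto simp: scalar_def)
    then show ?thesis
      by (simp add: xgen_def cls T.twist_subst_gen finsum_C_R4)
  qed
  with iso sum_sq sphere_star_iso[OF iso sum_sq]
  show "\<exists>\<rho> \<in> graded_star_iso (C_R4 \<psi>) (C_R4_semicross j \<phi>).
         (\<forall>\<mu>. \<rho> (xgen \<psi> \<mu>) =
            (\<Oplus>\<^bsub>C_R4 \<phi>\<^esub>\<nu>\<in>UNIV.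
              (rep_sign n \<mu> * (if \<nu> = rho_perm j \<mu> then rho_coeff j \<mu> else 0)) \<odot>\<^bsub>C_R4 \<phi>\<^esub> xgen \<phi> \<nu>)) \<and>
         \<rho> (sum_sq \<psi>) = sum_sq \<phi> \<and>
         (\<exists>\<sigma> \<in> star_iso (C_S3 \<psi>) (C_S3_semicross j \<phi>).
            \<forall>a \<in> carrier (C_R4 \<psi>).
              \<sigma> (sphere_ideal (C_R4 \<psi>) (sum_sq \<psi>) +>\<^bsub>C_R4 \<psi>\<^esub> a) =
              sphere_ideal (C_R4_semicross j \<phi>) (sum_sq \<phi>) +>\<^bsub>C_R4_semicross j \<phi>\<^esub> \<rho> a)"
    by (intro bexI[of _ "(`) T.twist_subst"]) auto
qed

end
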